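(* Let $\nu_1,\nu_2$ be real numbers with $0<\nu_1\leq\nu_2$ and $\nu_1+\nu_2=1$, and let $\xi_1,\xi_2$ be real numbers such that $1,\xi_1,\xi_2$ are linearly independent over $\mathbb{Q}$. For $q>0$ let $$\mathcal{B}(q)=\{(p_0,p_1,p_2)\in\mathbb{R}^3:\ |p_0|\leq e^{q},\ |p_1|\leq e^{-\nu_1 q},\ |p_2|\leq e^{-\nu_2 q}\},$$ and let $\Lambda=\{(x,\ \xi_1x-y_1,\ \xi_2x-y_2):\ (x,y_1,y_2)\in\mathbb{Z}^3\}$. For $i=1,2,3$ let $\lambda_i(q)$ be the $i$-th successive minimum of $\mathcal{B}(q)$ with respect to $\Lambda$, i.e. the least $\lambda>0$ such that $\lambda\mathcal{B}(q)$ contains $i$ linearly independent points of $\Lambda$, and put $L_i(q)=\log\lambda_i(q)$. Define $$\underline{\varphi}_i^{\mathbf{w}}=\liminf_{q\to\infty}\frac{L_i(q)}{q},\qquad \overline{\varphi}_i^{\mathbf{w}}=\limsup_{q\to\infty}\frac{L_i(q)}{q}\qquad(i=1,2,3),$$ where $\mathbf{w}=(\nu_1,\nu_2)$. Assume that $\overline{\varphi}_3^{\mathbf{w}}<\nu_1$. Then $$(2-\nu_1)\overline{\varphi}_1^{\mathbf{w}}+(1+\nu_1)\underline{\varphi}_3^{\mathbf{w}}\ \leq\ -3\,\overline{\varphi}_1^{\mathbf{w}}\,\underline{\varphi}_3^{\mathbf{w}}\ \leq\ (2-\nu_2)\overline{\varphi}_1^{\mathbf{w}}+(1+\nu_2)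\underline{\varphi}_3^{\mathbf{w}}.$$
   Context: Successive minima are taken for the convex symmetric body $\mathcal{B}(q)$ and the full-rank lattice $\Lambda\subset\mathbb{R}^3$; the quantities $\underline{\varphi}_i^{\mathbf{w}},\overline{\varphi}_i^{\mathbf{w}}$ are finite and quantify weighted simultaneous approximation to $(\xi_1,\xi_2)$ with weight $\mathbf{w}=(\nu_1,\nu_2)$. *)

theory Defs
  imports "HOL-Analysis.Analysis"
begin

text \<open>Linear independence is over the reals. The least element exists whenever \<open>K\<close> is a compact
  neighbourhood of the origin, star-shaped about it, and \<open>\<Lambda>\<close> is a discrete subgroup of rank at
  least \<open>i\<close>, with \<open>i \<ge> 1\<close>.\<close>
definition successive_minimum :: "nat \<Rightarrow> 'a::real_vector set \<Rightarrow> 'a set \<Rightarrow> real" where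
  "successive_minimum i K \<Lambda> =
    (LEAST l. l > 0 \<and>
      (\<exists>S. S \<subseteq> \<Lambda> \<inter> (\<lambda>x. l *\<^sub>R x) ` K \<and> independent S \<and> card S = i))"

text \<open>The components \<open>1, 2, 3\<close> of a vector are the coordinates \<open>p\<^sub>0, p\<^sub>1, p\<^sub>2\<close>.\<close>
definition weighted_body :: "real \<Rightarrow> real \<Rightarrow> real \<Rightarrow> (real ^ 3) set" where
  "weighted_body \<nu>1 \<nu>2 q =
    {p. \<bar>p $ 1\<bar> \<le> exp q \<and> \<bar>p $ 2\<bar> \<le> exp (- \<nu>1 * q) \<and> \<bar>p $ 3\<bar> \<le> exp (- \<nu>2 * q)}"

definition approx_lattice :: "real \<Rightarrow> real \<Rightarrow> (real ^ 3) set" where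
  "approx_lattice \<xi>1 \<xi>2 =
    {vector [of_int x, \<xi>1 * of_int x - of_int y1, \<xi>2 * of_int x - of_int y2] | x y1 y2 :: int. True}"

definition log_minimum :: "real \<Rightarrow> real \<Rightarrow> real \<Rightarrow> real \<Rightarrow> nat \<Rightarrow> real \<Rightarrow> real" where
  "log_minimum \<nu>1 \<nu>2 \<xi>1 \<xi>2 i q =
    ln (successive_minimum i (weighted_body \<nu>1 \<nu>2 q) (approx_lattice \<xi>1 \<xi>2))"

text \<open>The lower and upper limits are taken in the extended reals.\<close>
definition phi_lower :: "real \<Rightarrow> real \<Rightarrow> real \<Rightarrow> real \<Rightarrow> nat \<Rightarrow> ereal" where
  "phi_lower \<nu>1 \<nu>2 \<xi>1 \<xi>2 i = Liminf at_top (\<lambda>q. ereal (log_minimum \<nu>1 \<nu>2 \<xi>1 \<xi>2 i q / q))"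

definition phi_upper :: "real \<Rightarrow> real \<Rightarrow> real \<Rightarrow> real \<Rightarrow> nat \<Rightarrow> ereal" where
  "phi_upper \<nu>1 \<nu>2 \<xi>1 \<xi>2 i = Limsup at_top (\<lambda>q. ereal (log_minimum \<nu>1 \<nu>2 \<xi>1 \<xi>2 i q / q))"

end

(*
  Write h_q(p) for the factor by which the body at parameter q must be dilated to reach p, and let
  the dual lattice consist of the vectors (a + b xi1 + c xi2, -b, -c), measured at -q. Cross
  products map pairs of points of either lattice to the other one with h_{-q}(x * y) <= 2 h_q(x)
  h_q(y), and the first minimum of the dual lattice is 1 / lambda_3 up to constants.

  For the second inequality let x be a minimal lattice point at t. If lambda_1(q) <= exp(-alpha q)
  for all large q, then at the parameter s where h_s(x) overtakes this bound there is a second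
  independent lattice point y, and the dual point x * y is small at s. Moving it back to t gives
  a lower bound for log lambda_3(t), linear in t and s - t; another one comes from
  1 <= 6 lambda_1 lambda_3^2. The two together eliminate s. For the first inequality the same
  argument is run in the dual lattice, where lambda_3(q) >= exp(beta q) provides the small points.
*)
theory Submission
  imports Defs
begin

unbundle cross3_syntax

section \<open>Minkowski reduction of triples in Euclidean 3-space\<close>

lemma finite_sublevel_min:
  fixes F :: "'a \<Rightarrow> real"
  assumes "x \<in> A" "\<And>R. finite {y \<in> A. F y \<le> R}"
  obtains m where "m \<in> A" "\<And>y. y \<in> A \<Longrightarrow> F m \<le> F y"
proof -
  let ?B = "{y \<in> A. F y \<le> F x}"
  have B: "finite ?B" "?B \<noteq> {}" using assms by auto
  obtain m where m: "is_arg_min F (\<lambda>y. y \<in> ?B) m"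
    using ex_is_arg_min_if_finite[OF B] by blast
  then have "F m \<le> F y" if "y \<in> A" for y
    using that by (cases "F y \<le> F x") (auto simp: is_arg_min_linorder)
  with m show thesis by (intro that[of m]) (auto simp: is_arg_min_def)
qed

text \<open>The squared determinant of the triple. Squaring makes it symmetric, so that sorting a
  triple by norm keeps its value.\<close>

definition triple_sq :: "real ^ 3 \<Rightarrow> real ^ 3 \<Rightarrow> real ^ 3 \<Rightarrow> real" where
  "triple_sq u v w = (w \<bullet> (u \<times> v))\<^sup>2"

text \<open>The right-hand side is the Gram determinant, in which the inequalities of a reduced
  triple can be inserted.\<close>

lemma triple_sq_gram:
  "triple_sq u v w = (u \<bullet> u) * (v \<bullet> v) * (w \<bullet> w) + 2 * ((u \<bullet> v) * (u \<bullet> w) * (v \<bullet> w))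
     - (u \<bullet> u) * (v \<bullet> w)\<^sup>2 - (v \<bullet> v) * (u \<bullet> w)\<^sup>2 - (w \<bullet> w) * (u \<bullet> v)\<^sup>2"
  unfolding triple_sq_def by (simp add: cross3_def inner_vec_def sum_3) algebra

lemma triple_sq_add:
  "triple_sq u (v + k *\<^sub>R u) w = triple_sq u v w"
  "triple_sq u v (w + k *\<^sub>R u + l *\<^sub>R v) = triple_sq u v w"
  unfolding triple_sq_def by (simp_all add: cross3_def inner_vec_def sum_3) algebra+

lemma triple_sq_swap:
  "triple_sq v u w = triple_sq u v w" "triple_sq u w v = triple_sq u v w"
  unfolding triple_sq_def by (simp_all add: cross3_def inner_vec_def sum_3) algebra+

text \<open>For a hexagonal configuration the three bounds by halves alone allow the Gram determinant to
  vanish; the hypothesis for negative \<open>p * q * r\<close> excludes it.\<close>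
lemma gram_lower_bound:
  fixes a b c p q r :: real
  assumes ab: "0 \<le> a" "a \<le> b" "b \<le> c" and h: "2 * \<bar>p\<bar> \<le> a" "2 * \<bar>q\<bar> \<le> a" "2 * \<bar>r\<bar> \<le> b"
    and neg: "p * q * r < 0 \<Longrightarrow> 2 * (\<bar>p\<bar> + \<bar>q\<bar> + \<bar>r\<bar>) \<le> a + b"
  shows "a * b * c \<le> 4 * (a * b * c + 2 * (p * q * r) - a * r\<^sup>2 - b * q\<^sup>2 - c * p\<^sup>2)"
proof -
  have sq: "2 * x\<^sup>2 \<le> m * \<bar>x\<bar>" if "2 * \<bar>x\<bar> \<le> m" for x m :: real
    using mult_right_mono[OF that, of "\<bar>x\<bar>"] by (simp add: power2_eq_square)
  have 1: "2 * (c * p\<^sup>2) \<le> a * c * \<bar>p\<bar>"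
    using mult_left_mono[OF sq[OF h(1)], of c] ab by (simp add: mult_ac)
  have 2: "2 * (b * q\<^sup>2) \<le> a * c * \<bar>q\<bar>"
  proof -
    have "2 * (b * q\<^sup>2) \<le> b * (a * \<bar>q\<bar>)"
      using mult_left_mono[OF sq[OF h(2)], of b] ab by (simp add: mult_ac)
    also have "\<dots> \<le> c * (a * \<bar>q\<bar>)" using ab by (intro mult_right_mono) auto
    finally show ?thesis by (simp add: mult_ac)
  qed
  have 3: "2 * (a * r\<^sup>2) \<le> a * c * \<bar>r\<bar>"
  proof -
    have "2 * (a * r\<^sup>2) \<le> a * (b * \<bar>r\<bar>)"
      using mult_left_mono[OF sq[OF h(3)], of a] ab by (simp add: mult_ac)
    also have "\<dots> \<le> a * (c * \<bar>r\<bar>)" using ab by (intro mult_left_mono mult_right_mono) auto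
    finally show ?thesis by (simp add: mult_ac)
  qed
  have le: "a * c * (2 * x) \<le> a * c * y" if "2 * x \<le> y" for x y
    using that ab by (intro mult_left_mono) auto
  have aac: "a * c * a \<le> a * b * c" using ab by (simp add: mult_left_mono mult_right_mono mult_ac)
  show ?thesis
  proof (cases "p * q * r < 0")
    case False
    \<comment> \<open>For \<open>p * q * r\<close> nonnegative each of the three subtracted terms is
      at most a quarter of \<open>a * b * c\<close>, so a quarter of it remains.\<close>
    have a2: "2 * (2 * (c * p\<^sup>2)) \<le> a * b * c" "2 * (2 * (b * q\<^sup>2)) \<le> a * b * c"
      using 1 2 le[OF h(1)] le[OF h(2)] aac by linarith+
    have a3: "2 * (2 * (a * r\<^sup>2)) \<le> a * b * c"
      using 3 le[OF h(3)] by (simp add: mult_ac)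
    have lin: "x \<le> 4 * (x + 2 * y - i - j - k)"
      if "2 * (2 * k) \<le> x" "2 * (2 * j) \<le> x" "2 * (2 * i) \<le> x" "0 \<le> y" for x y i j k :: real
      using that by (simp add: algebra_simps)
    show ?thesis using False by (intro lin a2 a3) simp
  next
    case True
    \<comment> \<open>Here the subtracted terms together take at most half of
      \<open>a * b * c\<close>, and the negative product \<open>2 * (p * q * r)\<close> at most
      another quarter.\<close>
    have "2 * (2 * (c * p\<^sup>2) + 2 * (b * q\<^sup>2) + 2 * (a * r\<^sup>2)) \<le> a * c * (2 * (\<bar>p\<bar> + \<bar>q\<bar> + \<bar>r\<bar>))"
      using 1 2 3 by (simp add: algebra_simps)
    also have "\<dots> \<le> a * c * (a + b)" by (rule le[OF neg[OF True]])
    also have "\<dots> \<le> 2 * (a * b * c)" using aac by (simp add: algebra_simps)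
    finally have s: "2 * (c * p\<^sup>2 + b * q\<^sup>2 + a * r\<^sup>2) \<le> a * b * c" by simp
    have "(2 * \<bar>p\<bar>) * (2 * \<bar>q\<bar>) * (2 * \<bar>r\<bar>) \<le> a * a * b"
      using ab h by (intro mult_mono) auto
    also have "\<dots> \<le> a * b * c"
      using mult_left_mono[of a c "a * b"] ab by (simp add: mult_ac)
    finally have "8 * \<bar>p * q * r\<bar> \<le> a * b * c" by (simp add: abs_mult)
    with s show ?thesis by (simp add: abs_if split: if_splits)
  qed
qed

text \<open>A triple of covolume one with least sum of squares is reduced in the sense of Minkowski.\<close>
lemma reduced_triple:
  fixes M :: "(real ^ 3) set"
  assumes add: "\<And>x y. x \<in> M \<Longrightarrow> y \<in> M \<Longrightarrow> x + y \<in> M" and minus: "\<And>x. x \<in> M \<Longrightarrow> - x \<in> M"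
    and fin: "\<And>R. finite {p \<in> M. norm p \<le> R}"
    and init: "u0 \<in> M" "v0 \<in> M" "w0 \<in> M" "triple_sq u0 v0 w0 = 1"
  obtains u v w where "u \<in> M" "v \<in> M" "w \<in> M" "triple_sq u v w = 1"
    "norm u \<le> norm v" "norm v \<le> norm w" "norm u * norm v * norm w \<le> 2"
proof -
  define T where "T = {(u, v, w). u \<in> M \<and> v \<in> M \<and> w \<in> M \<and> triple_sq u v w = 1}"
  define E where "E = (\<lambda>(u :: real ^ 3, v :: real ^ 3, w :: real ^ 3). u \<bullet> u + v \<bullet> v + w \<bullet> w)"
  have finT: "finite {z \<in> T. E z \<le> R}" for R
  proof (rule finite_subset)
    let ?F = "{p \<in> M. norm p \<le> sqrt R}"
    have n: "norm p \<le> sqrt R" if "p \<bullet> p + q \<bullet> q + s \<bullet> s \<le> R" for p q s :: "real ^ 3"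
    proof -
      have "p \<bullet> p \<le> R" using that inner_ge_zero[of q] inner_ge_zero[of s] by linarith
      then show ?thesis by (simp add: norm_eq_sqrt_inner)
    qed
    have "norm p \<le> sqrt R" "norm q \<le> sqrt R" "norm s \<le> sqrt R"
      if "p \<bullet> p + q \<bullet> q + s \<bullet> s \<le> R" for p q s :: "real ^ 3"
      using n[of p q s] n[of q p s] n[of s p q] that by (simp_all add: add_ac)
    then show "{z \<in> T. E z \<le> R} \<subseteq> Sigma ?F (\<lambda>_. Sigma ?F (\<lambda>_. ?F))"
      by (auto simp: T_def E_def)
    show "finite (Sigma ?F (\<lambda>_. Sigma ?F (\<lambda>_. ?F)))" by (intro finite_SigmaI fin)
  qed
  define P where "P u v w \<longleftrightarrow> (u, v, w) \<in> T \<and> (\<forall>z\<in>T. E (u, v, w) \<le> E z)" for u v w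
  obtain m where "m \<in> T" "\<And>y. y \<in> T \<Longrightarrow> E m \<le> E y"
    using finite_sublevel_min[OF _ finT, of "(u0, v0, w0)"] init by (auto simp: T_def)
  then have "P (fst m) (fst (snd m)) (snd (snd m))" by (simp add: P_def)
  then obtain u1 v1 w1 where P1: "P u1 v1 w1" by blast
  have swap: "P v u w" "P u w v" if "P u v w" for u v w
    using that by (auto simp: P_def T_def E_def triple_sq_swap add_ac)
  obtain u v w where P: "P u v w" and sorted: "norm u \<le> norm v" "norm v \<le> norm w"
  proof -
    consider "norm u1 \<le> norm v1" "norm v1 \<le> norm w1" | "norm u1 \<le> norm w1" "norm w1 \<le> norm v1"
      | "norm v1 \<le> norm u1" "norm u1 \<le> norm w1" | "norm v1 \<le> norm w1" "norm w1 \<le> norm u1"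
      | "norm w1 \<le> norm u1" "norm u1 \<le> norm v1" | "norm w1 \<le> norm v1" "norm v1 \<le> norm u1"
      by linarith
    then show thesis
      by cases (use P1 swap that in blast)+
  qed
  have M: "u \<in> M" "v \<in> M" "w \<in> M" "triple_sq u v w = 1"
    using P by (auto simp: P_def T_def)
  define a b c p q r where "a = u \<bullet> u" "b = v \<bullet> v" "c = w \<bullet> w" "p = u \<bullet> v" "q = u \<bullet> w" "r = v \<bullet> w"
  note defs = this
  have sgnM: "k *\<^sub>R x \<in> M" if "x \<in> M" "k = 1 \<or> k = - 1 \<or> k = 0" for k x
    using that minus add[of x "- x"] by auto
  \<comment> \<open>A minimal triple cannot improve when \<open>v\<close> is replaced by
    \<open>v + k *\<^sub>R u\<close>, a change that preserves the determinant. In \<open>E3\<close>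
    the value 0 is allowed so that one vector alone may be added to \<open>w\<close>.\<close>
  have E2: "0 \<le> k * k * a + 2 * k * p" if "k = 1 \<or> k = - 1 \<or> k = 0" for k
  proof -
    have "(u, v + k *\<^sub>R u, w) \<in> T"
      using M that by (auto simp: T_def triple_sq_add intro!: add sgnM)
    then have "E (u, v, w) \<le> E (u, v + k *\<^sub>R u, w)" using P by (auto simp: P_def)
    then show ?thesis by (simp add: E_def defs algebra_simps inner_commute)
  qed
  have E3: "0 \<le> k * k * a + l * l * b + 2 * k * q + 2 * l * r + 2 * k * l * p"
    if "k = 1 \<or> k = - 1 \<or> k = 0" "l = 1 \<or> l = - 1 \<or> l = 0" for k l
  proof -
    have "(u, v, w + k *\<^sub>R u + l *\<^sub>R v) \<in> T"
      using M that by (auto simp: T_def triple_sq_add intro!: add sgnM)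
    then have "E (u, v, w) \<le> E (u, v, w + k *\<^sub>R u + l *\<^sub>R v)" using P by (auto simp: P_def)
    then show ?thesis by (simp add: E_def defs algebra_simps inner_commute)
  qed
  have "a * b * c \<le> 4 * (a * b * c + 2 * (p * q * r) - a * r\<^sup>2 - b * q\<^sup>2 - c * p\<^sup>2)"
  proof (rule gram_lower_bound)
    show "0 \<le> a" "a \<le> b" "b \<le> c" using sorted by (simp_all add: defs norm_le)
    show "2 * \<bar>p\<bar> \<le> a" using E2[of 1] E2[of "-1"] by simp
    show "2 * \<bar>q\<bar> \<le> a" using E3[of 1 0] E3[of "-1" 0] by simp
    show "2 * \<bar>r\<bar> \<le> b" using E3[of 0 1] E3[of 0 "-1"] by simp
    \<comment> \<open>The terms \<open>k * q\<close>, \<open>l * r\<close> and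
      \<open>k * l * p\<close> have product \<open>p * q * r\<close> for all signs \<open>k\<close>,
      \<open>l\<close>. If this is negative, the signs that make the first two negative make the
      third negative as well, and \<open>E3\<close> gives the claim.\<close>
    show "2 * (\<bar>p\<bar> + \<bar>q\<bar> + \<bar>r\<bar>) \<le> a + b" if "p * q * r < 0"
      using that E3[of 1 1] E3[of 1 "-1"] E3[of "-1" 1] E3[of "-1" "-1"]
      by (auto simp: mult_less_0_iff zero_less_mult_iff)
  qed
  also have "\<dots> = 4" using M(4) by (simp add: triple_sq_gram defs)
  finally have "(norm u * norm v * norm w)\<^sup>2 \<le> 2\<^sup>2"
    by (simp add: power_mult_distrib defs power2_norm_eq_inner)
  then have "norm u * norm v * norm w \<le> 2" by (rule power2_le_imp_le) simp
  with M sorted show thesis by (rule that)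
qed

section \<open>Heights attached to the weighted bodies\<close>

locale weights =
  fixes \<nu>1 \<nu>2 :: real
  assumes pos: "0 < \<nu>1" and le: "\<nu>1 \<le> \<nu>2" and sum1: "\<nu>1 + \<nu>2 = 1"
begin

text \<open>The gauge of the weighted body at \<open>t\<close>. Negative \<open>t\<close> is
  allowed: there it measures points of the dual lattice.\<close>

definition hgt :: "real \<Rightarrow> real ^ 3 \<Rightarrow> real" where
  "hgt t p = max (\<bar>p $ 1\<bar> * exp (- t)) (max (\<bar>p $ 2\<bar> * exp (\<nu>1 * t)) (\<bar>p $ 3\<bar> * exp (\<nu>2 * t)))"

lemma hgt_le_iff:
  "hgt t p \<le> l \<longleftrightarrow>
    \<bar>p $ 1\<bar> \<le> l * exp t \<and> \<bar>p $ 2\<bar> \<le> l * exp (- \<nu>1 * t) \<and> \<bar>p $ 3\<bar> \<le> l * exp (- \<nu>2 * t)"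
  by (auto simp: hgt_def exp_minus field_simps)

lemma abs_le_hgt:
  "\<bar>p $ 1\<bar> \<le> hgt t p * exp t"
  "\<bar>p $ 2\<bar> \<le> hgt t p * exp (- \<nu>1 * t)"
  "\<bar>p $ 3\<bar> \<le> hgt t p * exp (- \<nu>2 * t)"
  using hgt_le_iff[of t p "hgt t p"] by auto

lemma hgt_nonneg: "0 \<le> hgt t p"
  by (simp add: hgt_def le_max_iff_disj)

lemma hgt_pos: "p \<noteq> 0 \<Longrightarrow> 0 < hgt t p"
  by (auto simp: hgt_def less_max_iff_disj vec_eq_iff forall_3)

lemma hgt_scaleR: "hgt t (r *\<^sub>R p) = \<bar>r\<bar> * hgt t p"
  by (simp add: hgt_def abs_mult max_mult_distrib_left mult.assoc)

lemma continuous_hgt: "continuous_on UNIV (\<lambda>t. hgt t p)"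
  unfolding hgt_def by (intro continuous_intros)

text \<open>The exponential factors at \<open>t\<close> and \<open>- t\<close> cancel coordinate by
  coordinate, so each of the three products is bounded by the product of the heights.\<close>

lemma hgt_inner: "\<bar>x \<bullet> f\<bar> \<le> 3 * (hgt t x * hgt (- t) f)"
proof -
  let ?P = "hgt t x * hgt (- t) f"
  have *: "\<bar>a * b\<bar> \<le> ?P"
    if "\<bar>a\<bar> \<le> hgt t x * exp u" "\<bar>b\<bar> \<le> hgt (- t) f * exp (- u)" for a b u
  proof -
    have "\<bar>a * b\<bar> \<le> (hgt t x * exp u) * (hgt (- t) f * exp (- u))"
      unfolding abs_mult by (intro mult_mono that) (auto simp: hgt_nonneg)
    then show ?thesis by (simp add: exp_minus field_simps)
  qed
  have "\<bar>x $ 1 * f $ 1\<bar> \<le> ?P" "\<bar>x $ 2 * f $ 2\<bar> \<le> ?P" "\<bar>x $ 3 * f $ 3\<bar> \<le> ?P"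
    using abs_le_hgt[of x t] abs_le_hgt[of f "- t"]
      *[of "x $ 1" t "f $ 1"] *[of "x $ 2" "- \<nu>1 * t" "f $ 2"] *[of "x $ 3" "- \<nu>2 * t" "f $ 3"]
    by simp_all
  then show ?thesis
    by (simp add: inner_vec_def sum_3)
qed

text \<open>Bounds a two by two minor, hence a coordinate of a cross product; \<open>z\<close>
  dominates the exponents of both products.\<close>

lemma abs_mult_diff_le:
  fixes a b c d :: real
  assumes "\<bar>a\<bar> \<le> A * exp u" "\<bar>b\<bar> \<le> B * exp v" "\<bar>c\<bar> \<le> A * exp u'" "\<bar>d\<bar> \<le> B * exp v'"
    and "u + v \<le> z" "u' + v' \<le> z" "0 \<le> A" "0 \<le> B"
  shows "\<bar>a * b - c * d\<bar> \<le> 2 * (A * B) * exp z"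
proof -
  have *: "\<bar>a * b\<bar> \<le> A * B * exp z"
    if "\<bar>a\<bar> \<le> A * exp u" "\<bar>b\<bar> \<le> B * exp v" "u + v \<le> z" for a b u v :: real
  proof -
    have "\<bar>a * b\<bar> \<le> (A * exp u) * (B * exp v)"
      unfolding abs_mult using assms(7,8) by (intro mult_mono that) auto
    also have "\<dots> = A * B * exp (u + v)"
      by (simp add: exp_add)
    also have "\<dots> \<le> A * B * exp z"
      using assms(7,8) that by (intro mult_left_mono) auto
    finally show ?thesis .
  qed
  show ?thesis
    using *[OF assms(1,2,5)] *[OF assms(3,4,6)] by linarith
qed

text \<open>Since \<nu>1 + \<nu>2 = 1, the exponents of the two factors in each minor add up to the
  exponent of that coordinate at \<open>- t\<close>.\<close>

lemma hgt_cross: "hgt (- t) (x \<times> y) \<le> 2 * (hgt t x * hgt t y)"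
proof -
  have s: "\<nu>1 * t + \<nu>2 * t = t"
    using sum1 by (metis distrib_right mult_1)
  show ?thesis
    unfolding hgt_le_iff cross3_def vector_3
    by (intro conjI; rule abs_mult_diff_le; (rule abs_le_hgt hgt_nonneg)?)
      (use s in \<open>simp_all add: algebra_simps\<close>)
qed

text \<open>From \<open>- s\<close> up to \<open>- t\<close> the term of the first coordinate
  decreases, and the other two grow at rates \<nu>1 and \<nu>2, hence at most \<nu>2.\<close>

lemma hgt_shift_le:
  assumes "t \<le> s" shows "hgt (- t) w \<le> exp (\<nu>2 * (s - t)) * hgt (- s) w"
proof -
  have "\<nu>1 * (s - t) \<le> \<nu>2 * (s - t)" "0 \<le> \<nu>2 * (s - t)"
    using assms pos le by (auto intro: mult_right_mono)
  then have **: "- s \<le> \<nu>2 * (s - t) - t" "\<nu>1 * s \<le> \<nu>2 * (s - t) + \<nu>1 * t"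
    "\<nu>2 * s \<le> \<nu>2 * (s - t) + \<nu>2 * t"
    using assms by (auto simp: algebra_simps)
  have *: "\<bar>z\<bar> \<le> exp (\<nu>2 * (s - t)) * hgt (- s) w * exp v"
    if "\<bar>z\<bar> \<le> hgt (- s) w * exp u" "u \<le> \<nu>2 * (s - t) + v" for z u v
  proof -
    have "hgt (- s) w * exp u \<le> hgt (- s) w * exp (\<nu>2 * (s - t) + v)"
      using that hgt_nonneg by (intro mult_left_mono) auto
    then show ?thesis using that(1) by (simp add: exp_add mult_ac)
  qed
  show ?thesis
    unfolding hgt_le_iff
    by (intro conjI; rule *; (rule abs_le_hgt)?) (use ** in simp_all)
qed

text \<open>Convexity of \<open>ln (hgt s x)\<close> in \<open>s\<close>: its slope is either \<open>-1\<close> up to \<open>t\<close> or at least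
  \<open>\<nu>1\<close> from \<open>t\<close> on.\<close>
lemma hgt_rising_or_falling:
  assumes "x \<noteq> 0"
  obtains (rising) "\<And>s. t \<le> s \<Longrightarrow> ln (hgt t x) + \<nu>1 * (s - t) \<le> ln (hgt s x)"
  | (falling) "\<And>s. s \<le> t \<Longrightarrow> ln (hgt s x) \<ge> ln (hgt t x) + (t - s)"
proof -
  note hp = hgt_pos[OF assms]
  have lnI: "ln (hgt t x) + d \<le> ln (hgt s x)" if "hgt t x * exp d \<le> hgt s x" for d s
  proof -
    have "ln (hgt t x * exp d) \<le> ln (hgt s x)" using that hp by (subst ln_le_cancel_iff) auto
    then show ?thesis using hp[of t] by (simp add: ln_mult)
  qed
  \<comment> \<open>The coordinate attaining the maximum at \<open>t\<close> decides: the first one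
    gives slope -1, the others give slope \<nu>1 or \<nu>2.\<close>
  consider "hgt t x = \<bar>x $ 1\<bar> * exp (- t)" | "hgt t x = \<bar>x $ 2\<bar> * exp (\<nu>1 * t)"
    | "hgt t x = \<bar>x $ 3\<bar> * exp (\<nu>2 * t)"
    unfolding hgt_def by linarith
  then show ?thesis
  proof cases
    case 1
    have "ln (hgt s x) \<ge> ln (hgt t x) + (t - s)" for s
      by (rule lnI, unfold 1 mult.assoc exp_add[symmetric]) (simp add: hgt_def)
    then show ?thesis using falling by blast
  next
    case 2
    have "ln (hgt s x) \<ge> ln (hgt t x) + \<nu>1 * (s - t)" for s
      by (rule lnI, unfold 2 mult.assoc exp_add[symmetric]) (simp add: hgt_def algebra_simps)
    then show ?thesis using rising by blast
  next
    case 3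
    have "ln (hgt s x) \<ge> ln (hgt t x) + \<nu>1 * (s - t)" if "t \<le> s" for s
    proof (rule lnI)
      have "hgt t x * exp (\<nu>1 * (s - t)) \<le> hgt t x * exp (\<nu>2 * (s - t))"
        using that le by (intro mult_left_mono) (auto simp: hgt_nonneg intro: mult_right_mono)
      also have "\<dots> = \<bar>x $ 3\<bar> * exp (\<nu>2 * s)"
        by (simp add: 3 mult.assoc algebra_simps flip: exp_add)
      also have "\<dots> \<le> hgt s x" by (simp add: hgt_def)
      finally show "hgt t x * exp (\<nu>1 * (s - t)) \<le> hgt s x" .
    qed
    then show ?thesis using rising by blast
  qed
qed

text \<open>From \<open>- s\<close> down to \<open>- t\<close> only the term of the first coordinate
  can grow. The fall of the height of \<open>x\<close> makes its second and third coordinates small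
  enough to compensate, and the whole cross product gains the factor
  \<open>exp (- \<nu>1 * (t - s))\<close>.\<close>

lemma hgt_cross_falling:
  assumes "s \<le> t" "ln (hgt t x) + (t - s) \<le> ln (hgt s x)" "x \<noteq> 0"
  shows "hgt (- t) (x \<times> y) \<le> 2 * (hgt s x * hgt s y) * exp (- \<nu>1 * (t - s))"
proof -
  note hp = hgt_pos[OF assms(3)]
  have "exp (ln (hgt t x) + (t - s)) \<le> exp (ln (hgt s x))"
    using assms(2) by simp
  then have "hgt t x * exp (t - s) \<le> hgt s x"
    using hp by (simp only: exp_add exp_ln)
  then have hts: "hgt t x \<le> hgt s x * exp (s - t)"
    using mult_right_mono[of "hgt t x * exp (t - s)" "hgt s x" "exp (s - t)"]
    by (simp add: mult.assoc flip: exp_add)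
  have A: "\<bar>z\<bar> \<le> hgt s x * exp (s - t + v)" if "\<bar>z\<bar> \<le> hgt t x * exp v" for z v
    using order_trans[OF that mult_right_mono[OF hts, of "exp v"]] by (simp add: exp_add mult_ac)
  have s: "\<nu>2 = 1 - \<nu>1" using sum1 by auto
  have m: "\<nu>1 * (t - s) \<le> \<nu>2 * (t - s)"
    using assms(1) le by (intro mult_right_mono) auto
  \<comment> \<open>Here \<open>x\<close> is estimated at \<open>t\<close> and \<open>y\<close> at
    \<open>s\<close>; for the other two coordinates heights at \<open>s\<close> suffice.\<close>
  have "\<bar>(x \<times> y) $ 1\<bar> \<le> 2 * (hgt s x * hgt s y) * exp (- \<nu>1 * (t - s) - t)"
    unfolding cross3_def vector_3
    by (rule abs_mult_diff_le; (rule A[OF abs_le_hgt(2)] A[OF abs_le_hgt(3)] abs_le_hgt hgt_nonneg)?)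
      (use m in \<open>simp_all add: s algebra_simps\<close>)
  moreover have "\<bar>(x \<times> y) $ 2\<bar> \<le> 2 * (hgt s x * hgt s y) * exp (- \<nu>1 * (t - s) + \<nu>1 * t)"
    unfolding cross3_def vector_3
    by (rule abs_mult_diff_le; (rule abs_le_hgt hgt_nonneg)?)
      (use m in \<open>simp_all add: s algebra_simps\<close>)
  moreover have "\<bar>(x \<times> y) $ 3\<bar> \<le> 2 * (hgt s x * hgt s y) * exp (- \<nu>1 * (t - s) + \<nu>2 * t)"
    unfolding cross3_def vector_3
    by (rule abs_mult_diff_le; (rule abs_le_hgt hgt_nonneg)?)
      (use m in \<open>simp_all add: s algebra_simps\<close>)
  ultimately show ?thesis
    unfolding hgt_le_iff mult.assoc[of _ "exp _" "exp _"] exp_add[symmetric] by simp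
qed

lemma continuous_ln_hgt: "x \<noteq> 0 \<Longrightarrow> continuous_on S (\<lambda>s. ln (hgt s x))"
  using hgt_pos[of x]
  by (intro continuous_on_ln continuous_on_subset[OF continuous_hgt]) (auto simp: less_imp_neq[symmetric])

text \<open>The parameter \<open>s\<close> is chosen on the side of \<open>t\<close> on which the height of \<open>x\<close> grows, at the
  point where it exceeds the available bound by a factor \<open>exp 1\<close>; a point \<open>y\<close> obeying the bound
  is then not a multiple of the minimal point \<open>x\<close>.\<close>
lemma crossing:
  assumes x: "x \<in> X" "x \<noteq> 0" and min: "\<forall>y\<in>X. y \<noteq> 0 \<longrightarrow> hgt t x \<le> hgt t y"
    and t: "lo \<le> t" "t \<le> hi"
    and small: "\<And>s. lo \<le> s \<Longrightarrow> s \<le> hi \<Longrightarrow> \<exists>y\<in>X. y \<noteq> 0 \<and> ln (hgt s y) \<le> c * s + d"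
    and hi: "c * hi + d + 1 \<le> ln (hgt t x) + \<nu>1 * (hi - t)"
    and lo: "c * lo + d + 1 \<le> ln (hgt t x) + (t - lo)"
  obtains s y where "lo \<le> s" "s \<le> hi" "y \<in> X" "x \<times> y \<noteq> 0"
    "ln (hgt (- s) (x \<times> y)) \<le> 2 * (c * s + d) + 1 + ln 2"
    "t \<le> s \<and> ln (hgt t x) \<le> c * s + d + 1 - \<nu>1 * (s - t) \<and>
       ln (hgt (- t) (x \<times> y)) \<le> 2 * (c * s + d) + 1 + ln 2 + \<nu>2 * (s - t)
     \<or> s \<le> t \<and> ln (hgt (- t) (x \<times> y)) \<le> 2 * (c * s + d) + 1 + ln 2 - \<nu>1 * (t - s)"
proof -
  note result = that
  define n where "n s = ln (hgt s x)" for s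
  have nt: "n t \<le> c * t + d"
    using small[OF t] min hgt_pos[of _ t] x unfolding n_def
    by (meson ln_le_cancel_iff order_trans)
  have cont: "continuous_on S (\<lambda>s. n s - (c * s + d + 1))" for S
    unfolding n_def by (intro continuous_intros continuous_ln_hgt x)
  have ln2: "ln (2 * (hgt u v * hgt u w)) = ln (hgt u v) + ln (hgt u w) + ln 2"
    if "v \<noteq> 0" "w \<noteq> 0" for u v w
    using hgt_pos[OF that(1), of u] hgt_pos[OF that(2), of u] by (simp add: ln_mult)
  \<comment> \<open>It remains to find \<open>s\<close> where the height of \<open>x\<close> exceeds
    the bound by exactly \<open>exp 1\<close>, on the side of \<open>t\<close> where that height
    grows.\<close>
  have point: thesis
    if s: "lo \<le> s" "s \<le> hi" "n s = c * s + d + 1"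
      and alt: "t \<le> s \<and> n t + \<nu>1 * (s - t) \<le> n s \<or> s \<le> t \<and> n t + (t - s) \<le> n s" for s
  proof -
    obtain y where y: "y \<in> X" "y \<noteq> 0" "ln (hgt s y) \<le> c * s + d"
      using small s by blast
    note hx = hgt_pos[OF x(2)] and hy = hgt_pos[OF y(2)]
    have less: "hgt s y < hgt s x"
    proof -
      have "ln (hgt s y) < ln (hgt s x)" using y(3) s(3) by (simp add: n_def)
      then show ?thesis using hx hy by simp
    qed
    have cr: "x \<times> y \<noteq> 0"
    \<comment> \<open>If \<open>y\<close> were \<open>r\<close> times \<open>x\<close>, then
      \<open>\<bar>r\<bar> < 1\<close> by the comparison at \<open>s\<close>, and \<open>y\<close>
      would beat the minimal point \<open>x\<close> at \<open>t\<close>.\<close>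
    proof
      assume "x \<times> y = 0"
      then obtain r where r: "y = r *\<^sub>R x"
        using x(2) by (auto simp: cross_eq_0 collinear_lemma)
      have "\<bar>r\<bar> < 1" using less hx[of s] by (simp add: r hgt_scaleR)
      moreover have "hgt t x \<le> \<bar>r\<bar> * hgt t x" using min y(1,2) by (auto simp: r hgt_scaleR)
      ultimately show False using hx[of t] by simp
    qed
    note hc = hgt_pos[OF cr]
    have "ln (hgt (- s) (x \<times> y)) \<le> ln (2 * (hgt s x * hgt s y))"
      using hgt_cross[of s x y] hc hx hy by simp
    then have b1: "ln (hgt (- s) (x \<times> y)) \<le> 2 * (c * s + d) + 1 + ln 2"
      using y(3) s(3) x y by (simp add: ln2 n_def)
    show thesis
    proof (rule result[OF s(1,2) y(1) cr b1])
      show "t \<le> s \<and> ln (hgt t x) \<le> c * s + d + 1 - \<nu>1 * (s - t) \<and>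
          ln (hgt (- t) (x \<times> y)) \<le> 2 * (c * s + d) + 1 + ln 2 + \<nu>2 * (s - t)
        \<or> s \<le> t \<and> ln (hgt (- t) (x \<times> y)) \<le> 2 * (c * s + d) + 1 + ln 2 - \<nu>1 * (t - s)"
        using alt
      proof (elim disjE conjE)
        assume a: "t \<le> s" "n t + \<nu>1 * (s - t) \<le> n s"
        have "ln (hgt (- t) (x \<times> y)) \<le> ln (exp (\<nu>2 * (s - t)) * hgt (- s) (x \<times> y))"
          using hgt_shift_le[OF a(1)] hc by simp
        also have "\<dots> = \<nu>2 * (s - t) + ln (hgt (- s) (x \<times> y))"
          using hc[of "- s"] by (simp add: ln_mult)
        finally show ?thesis using a b1 s(3) by (simp add: n_def)
      next
        assume a: "s \<le> t" "n t + (t - s) \<le> n s"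
        have "ln (hgt (- t) (x \<times> y)) \<le> ln (2 * (hgt s x * hgt s y) * exp (- \<nu>1 * (t - s)))"
          using hgt_cross_falling[OF a(1) a(2)[unfolded n_def] x(2)] hc hx hy by simp
        also have "\<dots> = ln (2 * (hgt s x * hgt s y)) - \<nu>1 * (t - s)"
          using hx[of s] hy[of s] by (subst ln_mult) auto
        finally show ?thesis using a y(3) s(3) x y by (simp add: ln2 n_def)
      qed
    qed
  qed
  show thesis
  proof (cases rule: hgt_rising_or_falling[OF x(2), of t])
    case 1
    \<comment> \<open>At \<open>t\<close> the height of \<open>x\<close> lies below the bound by
      \<open>nt\<close>; at \<open>hi\<close> the assumed growth has carried it past. The falling
      case uses \<open>lo\<close> in the same way.\<close>
    have "\<exists>s\<ge>t. s \<le> hi \<and> n s - (c * s + d + 1) = 0"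
      using nt hi 1[OF t(2)] t by (intro IVT' cont) (auto simp: n_def)
    then obtain s where "t \<le> s" "s \<le> hi" "n s = c * s + d + 1" by auto
    then show ?thesis using 1[of s] t by (intro point[of s] disjI1) (auto simp: n_def)
  next
    case 2
    have "\<exists>s\<ge>lo. s \<le> t \<and> n s - (c * s + d + 1) = 0"
      using nt lo 2[OF t(1)] t by (intro IVT2' cont) (auto simp: n_def)
    then obtain s where "lo \<le> s" "s \<le> t" "n s = c * s + d + 1" by auto
    then show ?thesis using 2[of s] t by (intro point[of s] disjI2) (auto simp: n_def)
  qed
qed

end

section \<open>The approximation lattice and its dual\<close>

lemma triple_sq_independent:
  assumes "triple_sq u v w \<noteq> 0"
  shows "independent {u, v, w}" "card {u, v, w} = 3"
proof -
  have z: "w \<bullet> (u \<times> v) \<noteq> 0" using assms by (simp add: triple_sq_def)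
  have d: "u \<noteq> v" "v \<noteq> w" "u \<noteq> w"
    using z by (auto simp: dot_cross_self)
  then show "card {u, v, w} = 3" by simp
  have "span {u, v} \<subseteq> {x. (u \<times> v) \<bullet> x = 0}"
    by (intro span_minimal subspace_hyperplane) (auto simp: dot_cross_self)
  then have w: "w \<notin> span {u, v}" using z by (auto simp: inner_commute)
  have u: "u \<notin> span {v}" using z by (auto simp: span_singleton dot_cross_self cross_mult_left)
  have "v \<noteq> 0" using z by auto
  then have "independent {w, u, v}"
    using w u d by (simp add: independent_insert)
  then show "independent {u, v, w}" by (simp add: insert_commute)
qed

lemma finite_abs_of_int_le: "finite {k :: int. \<bar>real_of_int k\<bar> \<le> R}"
proof (rule finite_subset)
  show "{k :: int. \<bar>real_of_int k\<bar> \<le> R} \<subseteq> {- \<lceil>R\<rceil>..\<lceil>R\<rceil>}"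
    by (auto simp: abs_le_iff) linarith+
qed simp

locale weighted_lattice = weights +
  fixes \<xi>1 \<xi>2 :: real
begin

abbreviation lattice :: "(real ^ 3) set" where
  "lattice \<equiv> approx_lattice \<xi>1 \<xi>2"

text \<open>The signs are chosen so that the points with coefficients \<open>(x, y1, y2)\<close> in
  the lattice and \<open>(a, b, c)\<close> in the dual have inner product
  \<open>x * a + y1 * b + y2 * c\<close>, an integer.\<close>

definition dual :: "(real ^ 3) set" where
  "dual = {vector [of_int a + of_int b * \<xi>1 + of_int c * \<xi>2, - of_int b, - of_int c] | a b c :: int. True}"

lemma lattice_iff:
  "p \<in> lattice \<longleftrightarrow> (\<exists>x y1 y2. p $ 1 = of_int x \<and> p $ 2 = \<xi>1 * of_int x - of_int y1 \<and>
     p $ 3 = \<xi>2 * of_int x - of_int y2)"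
  by (auto simp: approx_lattice_def vec_eq_iff forall_3)

lemma dual_iff:
  "p \<in> dual \<longleftrightarrow> (\<exists>a b c. p $ 1 = of_int a + of_int b * \<xi>1 + of_int c * \<xi>2 \<and>
     p $ 2 = - of_int b \<and> p $ 3 = - of_int c)"
  by (auto simp: dual_def vec_eq_iff forall_3)

lemma lattice_add:
  assumes "p \<in> lattice" "q \<in> lattice" shows "p + q \<in> lattice"
proof -
  obtain x y1 y2 x' y1' y2' :: int where
    "p $ 1 = x" "p $ 2 = \<xi>1 * x - y1" "p $ 3 = \<xi>2 * x - y2"
    "q $ 1 = x'" "q $ 2 = \<xi>1 * x' - y1'" "q $ 3 = \<xi>2 * x' - y2'"
    using assms unfolding lattice_iff by blast
  then show ?thesis
    unfolding lattice_iff
    by (intro exI[of _ "x + x'"] exI[of _ "y1 + y1'"] exI[of _ "y2 + y2'"])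
      (simp add: algebra_simps)
qed

lemma lattice_minus:
  assumes "p \<in> lattice" shows "- p \<in> lattice"
proof -
  obtain x y1 y2 :: int where "p $ 1 = x" "p $ 2 = \<xi>1 * x - y1" "p $ 3 = \<xi>2 * x - y2"
    using assms unfolding lattice_iff by blast
  then show ?thesis
    unfolding lattice_iff
    by (intro exI[of _ "- x"] exI[of _ "- y1"] exI[of _ "- y2"]) simp
qed

text \<open>The standard basis of the lattice has determinant one, so the coefficient vector of a
  cross product is the cross product of the integer coefficient vectors. The same holds in
  \<open>cross_dual\<close>.\<close>

lemma cross_lattice:
  assumes "p \<in> lattice" "q \<in> lattice" shows "p \<times> q \<in> dual"
proof -
  obtain x y1 y2 x' y1' y2' :: int where e:
    "p $ 1 = x" "p $ 2 = \<xi>1 * x - y1" "p $ 3 = \<xi>2 * x - y2"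
    "q $ 1 = x'" "q $ 2 = \<xi>1 * x' - y1'" "q $ 3 = \<xi>2 * x' - y2'"
    using assms unfolding lattice_iff by blast
  show ?thesis
    unfolding dual_iff cross3_def vector_3 e
    by (intro exI[of _ "y1 * y2' - y2 * y1'"] exI[of _ "x' * y2 - x * y2'"]
        exI[of _ "x * y1' - x' * y1"]) (simp add: algebra_simps)
qed

lemma cross_dual:
  assumes "p \<in> dual" "q \<in> dual" shows "p \<times> q \<in> lattice"
proof -
  obtain a b c a' b' c' :: int where e:
    "p $ 1 = a + b * \<xi>1 + c * \<xi>2" "p $ 2 = - of_int b" "p $ 3 = - of_int c"
    "q $ 1 = a' + b' * \<xi>1 + c' * \<xi>2" "q $ 2 = - of_int b'" "q $ 3 = - of_int c'"
    using assms unfolding dual_iff by blast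
  show ?thesis
    unfolding lattice_iff cross3_def vector_3 e
    by (intro exI[of _ "b * c' - c * b'"] exI[of _ "c * a' - a * c'"] exI[of _ "a * b' - b * a'"])
      (simp add: algebra_simps)
qed

lemma abs_inner_ge_1:
  assumes "p \<in> lattice" "f \<in> dual" "p \<bullet> f \<noteq> 0" shows "1 \<le> \<bar>p \<bullet> f\<bar>"
proof -
  obtain x y1 y2 a b c :: int where e:
    "p $ 1 = x" "p $ 2 = \<xi>1 * x - y1" "p $ 3 = \<xi>2 * x - y2"
    "f $ 1 = a + b * \<xi>1 + c * \<xi>2" "f $ 2 = - of_int b" "f $ 3 = - of_int c"
    using assms unfolding lattice_iff dual_iff by blast
  have "p \<bullet> f = of_int (x * a + y1 * b + y2 * c)"
    unfolding inner_vec_def sum_3 e by (simp add: algebra_simps)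
  with assms(3) show ?thesis
    by (metis Ints_of_int Ints_nonzero_abs_ge1)
qed

lemma finite_lattice: "finite {p \<in> lattice. hgt t p \<le> R}"
proof -
  define A B C where "A = R * exp t" "B = R * exp (- \<nu>1 * t)" "C = R * exp (- \<nu>2 * t)"
  define K where "K = {k :: int. \<bar>real_of_int k\<bar> \<le> A + (\<bar>\<xi>1\<bar> * A + B) + (\<bar>\<xi>2\<bar> * A + C)}"
  let ?g = "\<lambda>(x, y1, y2). vector [of_int x, \<xi>1 * of_int x - of_int y1, \<xi>2 * of_int x - of_int y2] :: real ^ 3"
  have "{p \<in> lattice. hgt t p \<le> R} \<subseteq> ?g ` (Sigma K (\<lambda>_. Sigma K (\<lambda>_. K)))"
  proof
    fix p assume p: "p \<in> {p \<in> lattice. hgt t p \<le> R}"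
    then obtain x y1 y2 :: int where c: "p $ 1 = x" "p $ 2 = \<xi>1 * x - y1" "p $ 3 = \<xi>2 * x - y2"
      unfolding lattice_iff by blast
    have b: "\<bar>real_of_int x\<bar> \<le> A" "\<bar>\<xi>1 * x - y1\<bar> \<le> B" "\<bar>\<xi>2 * x - y2\<bar> \<le> C"
      using p c by (auto simp: hgt_le_iff A_B_C_def)
    have m: "\<bar>\<xi> * x\<bar> \<le> \<bar>\<xi>\<bar> * A" for \<xi> :: real
      using b(1) by (simp add: abs_mult mult_left_mono)
    have "\<bar>real_of_int y1\<bar> \<le> \<bar>\<xi>1\<bar> * A + B" "\<bar>real_of_int y2\<bar> \<le> \<bar>\<xi>2\<bar> * A + C"
      using b m[of \<xi>1] m[of \<xi>2] by linarith+
    then have "x \<in> K" "y1 \<in> K" "y2 \<in> K"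
      using b(1) by (auto simp: K_def)
    then show "p \<in> ?g ` (Sigma K (\<lambda>_. Sigma K (\<lambda>_. K)))"
      by (intro image_eqI[of _ _ "(x, y1, y2)"]) (auto simp: vec_eq_iff forall_3 c)
  qed
  then show ?thesis
    by (rule finite_subset) (auto simp: K_def finite_abs_of_int_le)
qed

lemma finite_dual: "finite {p \<in> dual. hgt t p \<le> R}"
proof -
  define A B C where "A = R * exp t" "B = R * exp (- \<nu>1 * t)" "C = R * exp (- \<nu>2 * t)"
  define K where "K = {k :: int. \<bar>real_of_int k\<bar> \<le> (A + \<bar>\<xi>1\<bar> * B + \<bar>\<xi>2\<bar> * C) + B + C}"
  let ?g = "\<lambda>(a, b, c). vector [of_int a + of_int b * \<xi>1 + of_int c * \<xi>2, - of_int b, - of_int c] :: real ^ 3"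
  have "{p \<in> dual. hgt t p \<le> R} \<subseteq> ?g ` (Sigma K (\<lambda>_. Sigma K (\<lambda>_. K)))"
  proof
    fix p assume p: "p \<in> {p \<in> dual. hgt t p \<le> R}"
    then obtain a b c :: int where e: "p $ 1 = a + b * \<xi>1 + c * \<xi>2" "p $ 2 = - of_int b" "p $ 3 = - of_int c"
      unfolding dual_iff by blast
    have h: "\<bar>a + b * \<xi>1 + c * \<xi>2\<bar> \<le> A" "\<bar>real_of_int b\<bar> \<le> B" "\<bar>real_of_int c\<bar> \<le> C"
      using p e by (auto simp: hgt_le_iff A_B_C_def)
    have "\<bar>b * \<xi>1\<bar> \<le> \<bar>\<xi>1\<bar> * B" "\<bar>c * \<xi>2\<bar> \<le> \<bar>\<xi>2\<bar> * C"
      using mult_left_mono[OF h(2), of "\<bar>\<xi>1\<bar>"] mult_left_mono[OF h(3), of "\<bar>\<xi>2\<bar>"]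
      by (simp_all add: abs_mult mult.commute)
    then have "\<bar>real_of_int a\<bar> \<le> A + \<bar>\<xi>1\<bar> * B + \<bar>\<xi>2\<bar> * C"
      using h by linarith
    then have "a \<in> K" "b \<in> K" "c \<in> K"
      using h(2,3) by (auto simp: K_def)
    then show "p \<in> ?g ` (Sigma K (\<lambda>_. Sigma K (\<lambda>_. K)))"
      by (intro image_eqI[of _ _ "(a, b, c)"]) (auto simp: vec_eq_iff forall_3 e)
  qed
  then show ?thesis
    by (rule finite_subset) (auto simp: K_def finite_abs_of_int_le)
qed

lemma lattice_min:
  obtains x where "x \<in> lattice" "x \<noteq> 0" "\<forall>y\<in>lattice. y \<noteq> 0 \<longrightarrow> hgt t x \<le> hgt t y"
proof -
  have "vector [0, - 1, 0] \<in> lattice - {0}"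
    by (auto simp: lattice_iff vec_eq_iff forall_3 intro!: exI[of _ 0] exI[of _ 1])
  then obtain m where "m \<in> lattice - {0}" "\<And>y. y \<in> lattice - {0} \<Longrightarrow> hgt t m \<le> hgt t y"
    using finite_sublevel_min[of _ "lattice - {0}" "hgt t"] finite_subset[OF _ finite_lattice[of t]]
    by (metis (mono_tags, lifting) Collect_mono DiffD1)
  then show thesis using that[of m] by blast
qed

lemma dual_min:
  obtains x where "x \<in> dual" "x \<noteq> 0" "\<forall>y\<in>dual. y \<noteq> 0 \<longrightarrow> hgt t x \<le> hgt t y"
proof -
  have "vector [1, 0, 0] \<in> dual - {0}"
    by (auto simp: dual_iff vec_eq_iff forall_3 intro!: exI[of _ 0] exI[of _ 1])
  then obtain m where "m \<in> dual - {0}" "\<And>y. y \<in> dual - {0} \<Longrightarrow> hgt t m \<le> hgt t y"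
    using finite_sublevel_min[of _ "dual - {0}" "hgt t"] finite_subset[OF _ finite_dual[of t]]
    by (metis (mono_tags, lifting) Collect_mono DiffD1)
  then show thesis using that[of m] by blast
qed

section \<open>Reduced triples of lattice points at a given parameter\<close>

text \<open>The diagonal map of determinant one that carries the body at \<open>t\<close> to the
  unit cube, so that \<open>hgt t\<close> becomes the maximum norm.\<close>

definition scale :: "real \<Rightarrow> real ^ 3 \<Rightarrow> real ^ 3" where
  "scale t p = vector [p $ 1 * exp (- t), p $ 2 * exp (\<nu>1 * t), p $ 3 * exp (\<nu>2 * t)]"

lemma scale_simps:
  "scale t p $ 1 = p $ 1 * exp (- t)" "scale t p $ 2 = p $ 2 * exp (\<nu>1 * t)"
  "scale t p $ 3 = p $ 3 * exp (\<nu>2 * t)"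
  by (simp_all add: scale_def)

lemma hgt_le_norm: "hgt t p \<le> norm (scale t p)"
  using component_le_norm_cart[of "scale t p" 1] component_le_norm_cart[of "scale t p" 2]
    component_le_norm_cart[of "scale t p" 3]
  by (simp add: hgt_def scale_simps abs_mult)

text \<open>The cofactor matrix of \<open>scale t\<close> is \<open>scale (- t)\<close>, because the
  determinant is one.\<close>

lemma scale_cross: "scale (- t) (u \<times> v) = scale t u \<times> scale t v"
proof -
  have "exp (\<nu>1 * t) * exp (\<nu>2 * t) = exp t" "exp (\<nu>2 * t) * exp (- t) = exp (- (\<nu>1 * t))"
    "exp (- t) * exp (\<nu>1 * t) = exp (- (\<nu>2 * t))"
    using sum1 by (simp_all add: field_simps flip: exp_add distrib_left distrib_right)
  note e = this[symmetric]
  show ?thesis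
    by (simp add: vec_eq_iff forall_3 scale_simps cross3_def) (simp add: e algebra_simps)
qed

lemma triple_sq_scale: "triple_sq (scale t u) (scale t v) (scale t w) = triple_sq u v w"
proof -
  have "scale t w \<bullet> scale (- t) x = w \<bullet> x" for x
    by (simp add: inner_vec_def sum_3 scale_simps exp_minus field_simps)
  then show ?thesis
    by (simp add: triple_sq_def flip: scale_cross)
qed

text \<open>The weak form of Minkowski's second theorem; \<open>m\<close> plays the role of the third minimum.\<close>
lemma reduced_lattice_triple:
  obtains u v w m where "u \<in> lattice" "v \<in> lattice" "w \<in> lattice" "triple_sq u v w = 1"
    "hgt t u \<le> m" "hgt t v \<le> m" "hgt t w \<le> m" "m * hgt (- t) (u \<times> v) \<le> 2" "(hgt t u)\<^sup>2 * m \<le> 2"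
proof -
  let ?M = "scale t ` lattice"
  have "scale t x + scale t y = scale t (x + y)" "- scale t x = scale t (- x)" for x y
    by (simp_all add: vec_eq_iff forall_3 scale_simps algebra_simps)
  then have closed: "\<And>x y. x \<in> ?M \<Longrightarrow> y \<in> ?M \<Longrightarrow> x + y \<in> ?M" "\<And>x. x \<in> ?M \<Longrightarrow> - x \<in> ?M"
    by (auto intro: lattice_add lattice_minus)
  have fin: "finite {p \<in> ?M. norm p \<le> R}" for R
    by (rule finite_subset[OF _ finite_imageI[OF finite_lattice[of t R], of "scale t"]])
      (auto intro: order_trans[OF hgt_le_norm])
  \<comment> \<open>The lattice basis with coefficients (1,0,0), (0,1,0), (0,0,1) is the triple of
    covolume one from which the reduction starts.\<close>
  have "\<exists>x y1 y2. vector [1, \<xi>1, \<xi>2] = (vector [of_int x, \<xi>1 * of_int x - of_int y1,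
      \<xi>2 * of_int x - of_int y2] :: real ^ 3)"
    by (intro exI[of _ 1] exI[of _ 0]) simp
  moreover have "\<exists>x y1 y2. vector [0, - 1, 0] = (vector [of_int x, \<xi>1 * of_int x - of_int y1,
      \<xi>2 * of_int x - of_int y2] :: real ^ 3)"
    by (rule exI[of _ 0], rule exI[of _ 1], rule exI[of _ 0]) simp
  moreover have "\<exists>x y1 y2. vector [0, 0, - 1] = (vector [of_int x, \<xi>1 * of_int x - of_int y1,
      \<xi>2 * of_int x - of_int y2] :: real ^ 3)"
    by (rule exI[of _ 0], rule exI[of _ 0], rule exI[of _ 1]) simp
  ultimately have "vector [1, \<xi>1, \<xi>2] \<in> lattice" "vector [0, - 1, 0] \<in> lattice"
    "vector [0, 0, - 1] \<in> lattice"
    by (auto simp: approx_lattice_def)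
  moreover have "triple_sq (scale t (vector [1, \<xi>1, \<xi>2])) (scale t (vector [0, - 1, 0]))
      (scale t (vector [0, 0, - 1])) = 1"
    unfolding triple_sq_scale by (simp add: triple_sq_def cross3_def inner_vec_def sum_3)
  ultimately obtain u v w where uvw: "u \<in> lattice" "v \<in> lattice" "w \<in> lattice"
    "triple_sq u v w = 1" "norm (scale t u) \<le> norm (scale t v)" "norm (scale t v) \<le> norm (scale t w)"
    "norm (scale t u) * norm (scale t v) * norm (scale t w) \<le> 2"
    using reduced_triple[OF closed fin] by (smt (verit) imageE imageI triple_sq_scale)
  \<comment> \<open>The Euclidean norm of the longest reduced vector bounds all three heights. The
    cross product of the other two is at most the product of their norms, hence at most 2 divided by
    this norm.\<close>
  let ?m = "norm (scale t w)"
  have "hgt (- t) (u \<times> v) \<le> norm (scale t u) * norm (scale t v)"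
  proof -
    have "(norm (scale t u \<times> scale t v))\<^sup>2 \<le> (norm (scale t u) * norm (scale t v))\<^sup>2"
      using norm_cross_dot[of "scale t u" "scale t v"] by (smt (verit) zero_le_power2)
    then show ?thesis
      using hgt_le_norm[of "- t" "u \<times> v"] by (simp add: scale_cross)
  qed
  then have "?m * hgt (- t) (u \<times> v) \<le> ?m * (norm (scale t u) * norm (scale t v))"
    by (rule mult_left_mono) simp
  then have 1: "?m * hgt (- t) (u \<times> v) \<le> 2" using uvw(7) by (simp add: mult_ac)
  have "hgt t u \<le> norm (scale t u)" "hgt t u \<le> norm (scale t v)"
    using hgt_le_norm[of t u] uvw(5) by linarith+
  then have "(hgt t u)\<^sup>2 * ?m \<le> norm (scale t u) * norm (scale t v) * ?m"
    unfolding power2_eq_square by (intro mult_right_mono mult_mono) (auto simp: hgt_nonneg)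
  then have 2: "(hgt t u)\<^sup>2 * ?m \<le> 2" using uvw(7) by linarith
  show thesis
    using hgt_le_norm[of t u] hgt_le_norm[of t v] hgt_le_norm[of t w] uvw 1 2
    by (intro that[of u v w ?m]) linarith+
qed

section \<open>Successive minima and transference\<close>

definition lam :: "nat \<Rightarrow> real \<Rightarrow> real" where
  "lam i t = successive_minimum i (weighted_body \<nu>1 \<nu>2 t) lattice"

lemma mem_scaled_body:
  assumes "0 < l"
  shows "p \<in> (\<lambda>x. l *\<^sub>R x) ` weighted_body \<nu>1 \<nu>2 t \<longleftrightarrow> hgt t p \<le> l"
proof -
  have "p \<in> (\<lambda>x. l *\<^sub>R x) ` weighted_body \<nu>1 \<nu>2 t \<longleftrightarrow> inverse l *\<^sub>R p \<in> weighted_body \<nu>1 \<nu>2 t"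
    using assms by (force simp: image_iff)
  then show ?thesis
    using assms by (simp add: weighted_body_def hgt_le_iff abs_mult field_simps)
qed

text \<open>Only finitely many independent sets of size \<open>i\<close> have bounded maximal
  height, so the least dilation is attained and equals the minimum of \<open>F\<close> over these
  sets. The set \<open>S0\<close> shows that there is at least one.\<close>

lemma lam_props:
  assumes S0: "S0 \<subseteq> lattice" "independent S0" "card S0 = i" and i: "0 < i"
  shows "\<exists>S. S \<subseteq> lattice \<and> independent S \<and> card S = i \<and> (\<forall>p\<in>S. hgt t p \<le> lam i t)" (is ?attained)
    and "(\<And>p. p \<in> S0 \<Longrightarrow> hgt t p \<le> l) \<Longrightarrow> lam i t \<le> l"
proof -
  define A where "A = {S. S \<subseteq> lattice \<and> independent S \<and> card S = i}"
  define F where "F S = Max (hgt t ` S)" for S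
  have A: "finite S" "S \<noteq> {}" if "S \<in> A" for S
    using that i by (auto simp: A_def card_gt_0_iff)
  have F_le: "F S \<le> R \<longleftrightarrow> (\<forall>p\<in>S. hgt t p \<le> R)" if "S \<in> A" for S R
    using A[OF that] by (simp add: F_def)
  have fin: "finite {S \<in> A. F S \<le> R}" for R
    by (rule finite_subset[of _ "Pow {p \<in> lattice. hgt t p \<le> R}"])
      (use F_le in \<open>auto simp: finite_lattice A_def\<close>)
  have S0A: "S0 \<in> A" using S0 by (simp add: A_def)
  obtain m where m: "m \<in> A" "\<And>S. S \<in> A \<Longrightarrow> F m \<le> F S"
    using finite_sublevel_min[OF S0A fin] by blast
  have pos: "0 < F S" if SA: "S \<in> A" for S
  proof -
    obtain p where "p \<in> S" using A(2)[OF SA] by auto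
    moreover have "p \<noteq> 0" using SA dependent_zero \<open>p \<in> S\<close> by (auto simp: A_def)
    ultimately show ?thesis
      using A[OF SA] hgt_pos[of p t] by (auto simp: F_def Max_gr_iff)
  qed
  have lam: "lam i t = F m"
    unfolding lam_def successive_minimum_def
  proof (rule Least_equality)
    show "F m > 0 \<and> (\<exists>S. S \<subseteq> lattice \<inter> (\<lambda>x. F m *\<^sub>R x) ` weighted_body \<nu>1 \<nu>2 t \<and> independent S \<and> card S = i)"
      using m(1) pos[OF m(1)] F_le[OF m(1), of "F m"] mem_scaled_body[OF pos[OF m(1)], of _ t]
      unfolding A_def by (intro conjI exI[of _ m] subsetI IntI) blast+
    show "F m \<le> l" if l0: "l > 0 \<and>
      (\<exists>S. S \<subseteq> lattice \<inter> (\<lambda>x. l *\<^sub>R x) ` weighted_body \<nu>1 \<nu>2 t \<and> independent S \<and> card S = i)" for l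
    proof -
      have l: "0 < l" using l0 by simp
      obtain S where S: "S \<subseteq> lattice \<inter> (\<lambda>x. l *\<^sub>R x) ` weighted_body \<nu>1 \<nu>2 t \<and>
          independent S \<and> card S = i"
        using l0[THEN conjunct2] by (rule exE)
      have "S \<in> A" using S by (simp add: A_def)
      moreover have "\<forall>p\<in>S. hgt t p \<le> l"
        using S[THEN conjunct1] by (simp add: subset_iff mem_scaled_body[OF l])
      ultimately show ?thesis using m(2)[of S] F_le[of S l] by simp
    qed
  qed
  show ?attained
    using m(1) F_le[OF m(1), of "F m"] by (intro exI[of _ m]) (auto simp: lam A_def)
  show "lam i t \<le> l" if "\<And>p. p \<in> S0 \<Longrightarrow> hgt t p \<le> l"
    using that m(2)[OF S0A] F_le[OF S0A, of l] by (simp add: lam)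
qed

lemma lam1_le: "x \<in> lattice \<Longrightarrow> x \<noteq> 0 \<Longrightarrow> lam 1 t \<le> hgt t x"
  by (rule lam_props(2)[of "{x}"]) auto

lemma lam1_min:
  assumes "x \<in> lattice" "x \<noteq> 0" "\<forall>y\<in>lattice. y \<noteq> 0 \<longrightarrow> hgt t x \<le> hgt t y"
  shows "lam 1 t = hgt t x"
proof (rule antisym)
  show "lam 1 t \<le> hgt t x" using assms by (intro lam1_le)
  obtain S where "S \<subseteq> lattice" "independent S" "card S = 1" "\<forall>p\<in>S. hgt t p \<le> lam 1 t"
    using lam_props(1)[of "{x}" 1 t] assms(1,2) by auto
  then show "hgt t x \<le> lam 1 t"
    using assms(3) dependent_zero by (metis card_1_singletonE insertI1 order_trans subset_iff)
qed

lemma lam1_pos: "0 < lam 1 t"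
  using lattice_min[of t] lam1_min hgt_pos by metis

lemma lam3_props:
  obtains S where "S \<subseteq> lattice" "independent S" "card S = 3" "\<forall>p\<in>S. hgt t p \<le> lam 3 t"
proof -
  obtain u v w where r: "u \<in> lattice" "v \<in> lattice" "w \<in> lattice" "triple_sq u v w = 1"
    by (rule reduced_lattice_triple)
  then have "{u, v, w} \<subseteq> lattice" "triple_sq u v w \<noteq> 0" by auto
  then show thesis
    using lam_props(1)[of "{u, v, w}" 3 t] triple_sq_independent[of u v w] that by auto
qed

lemma lam1_le_lam3: "lam 1 t \<le> lam 3 t"
proof -
  obtain S where S: "S \<subseteq> lattice" "independent S" "card S = 3" "\<forall>p\<in>S. hgt t p \<le> lam 3 t"
    using lam3_props[of t] by blast
  then obtain p where "p \<in> S" by (metis card.empty ex_in_conv zero_neq_numeral)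
  then show ?thesis
    using S lam1_le[of p t] dependent_zero by (metis order_trans subset_iff)
qed

lemma lam3_pos: "0 < lam 3 t"
  using lam1_pos lam1_le_lam3 by (rule less_le_trans)

text \<open>Three independent points cannot all be orthogonal to \<open>f\<close>. One that realises
  the third minimum therefore has a nonzero integer inner product with \<open>f\<close>, and
  \<open>hgt_inner\<close> applies.\<close>

lemma lam3_ge:
  assumes "f \<in> dual" "f \<noteq> 0" shows "1 \<le> 3 * lam 3 t * hgt (- t) f"
proof -
  obtain S where S: "S \<subseteq> lattice" "independent S" "card S = 3" "\<forall>p\<in>S. hgt t p \<le> lam 3 t"
    using lam3_props[of t] by blast
  have "\<not> S \<subseteq> {p. f \<bullet> p = 0}"
  proof
    assume *: "S \<subseteq> {p. f \<bullet> p = 0}"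
    have "dim {p. f \<bullet> p = 0} = 2"
      using dim_hyperplane[OF assms(2)] by simp
    with * S(2,3) show False
      using independent_card_le_dim[of S "{p. f \<bullet> p = 0}"] by simp
  qed
  then obtain p where p: "p \<in> S" "p \<bullet> f \<noteq> 0" by (auto simp: inner_commute)
  have "1 \<le> \<bar>p \<bullet> f\<bar>" using p S assms by (intro abs_inner_ge_1) auto
  also have "\<dots> \<le> 3 * (hgt t p * hgt (- t) f)" by (rule hgt_inner)
  also have "\<dots> \<le> 3 * (lam 3 t * hgt (- t) f)"
    using S(4) p(1) by (simp add: mult_right_mono hgt_nonneg)
  finally show ?thesis by (simp add: mult.assoc)
qed

text \<open>The small dual point is the cross product of the two shorter vectors of a reduced
  triple. It is the converse of \<open>lam3_ge\<close> up to a constant.\<close>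

lemma dual_small: "\<exists>f\<in>dual. f \<noteq> 0 \<and> lam 3 t * hgt (- t) f \<le> 2"
  and lam1_lam3_le: "(lam 1 t)\<^sup>2 * lam 3 t \<le> 2"
proof -
  obtain u v w m where r: "u \<in> lattice" "v \<in> lattice" "w \<in> lattice" "triple_sq u v w = 1"
    "hgt t u \<le> m" "hgt t v \<le> m" "hgt t w \<le> m" "m * hgt (- t) (u \<times> v) \<le> 2" "(hgt t u)\<^sup>2 * m \<le> 2"
    by (rule reduced_lattice_triple)
  have nz: "u \<times> v \<noteq> 0" "u \<noteq> 0" using r(4) by (auto simp: triple_sq_def)
  have m: "lam 3 t \<le> m"
    using r triple_sq_independent[of u v w] by (intro lam_props(2)[of "{u, v, w}"]) auto
  then have "lam 3 t * hgt (- t) (u \<times> v) \<le> m * hgt (- t) (u \<times> v)"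
    by (intro mult_right_mono) (auto simp: hgt_nonneg)
  then show "\<exists>f\<in>dual. f \<noteq> 0 \<and> lam 3 t * hgt (- t) f \<le> 2"
    using r nz by (intro bexI[of _ "u \<times> v"]) (auto intro: cross_lattice)
  have "(lam 1 t)\<^sup>2 * lam 3 t \<le> (hgt t u)\<^sup>2 * m"
    using m lam1_le[OF r(1) nz(2)] lam1_pos[of t] lam3_pos[of t]
    by (intro mult_mono power_mono) auto
  with r(9) show "(lam 1 t)\<^sup>2 * lam 3 t \<le> 2" by linarith
qed

text \<open>A minimal point and one of three independent points outside its span have a nonzero
  cross product of dual height at most \<open>2 * lam 1 t * lam 3 t\<close>; then
  \<open>lam3_ge\<close> applies.\<close>

lemma lam1_lam3_ge: "1 \<le> 6 * lam 1 t * (lam 3 t)\<^sup>2"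
proof -
  obtain x where x: "x \<in> lattice" "x \<noteq> 0" "\<forall>y\<in>lattice. y \<noteq> 0 \<longrightarrow> hgt t x \<le> hgt t y"
    using lattice_min[of t] by blast
  obtain S where S: "S \<subseteq> lattice" "independent S" "card S = 3" "\<forall>p\<in>S. hgt t p \<le> lam 3 t"
    using lam3_props[of t] by blast
  have "\<not> S \<subseteq> span {x}"
  proof
    assume "S \<subseteq> span {x}"
    then have "card S \<le> dim {x}"
      using S(2) independent_card_le_dim[of S "span {x}"] by simp
    then show False using S(3) dim_le_card'[of "{x}"] by simp
  qed
  then obtain p where p: "p \<in> S" "p \<notin> span {x}" by blast
  then have nz: "x \<times> p \<noteq> 0" using x(2)
    by (auto simp: cross_eq_0 collinear_lemma span_singleton)
  have "1 \<le> 3 * lam 3 t * hgt (- t) (x \<times> p)"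
    using p S x nz by (intro lam3_ge cross_lattice) auto
  also have "\<dots> \<le> 3 * lam 3 t * (2 * (lam 1 t * lam 3 t))"
  proof (rule mult_left_mono)
    have "hgt (- t) (x \<times> p) \<le> 2 * (lam 1 t * hgt t p)"
      using hgt_cross[of t x p] lam1_min[OF x] by simp
    also have "\<dots> \<le> 2 * (lam 1 t * lam 3 t)"
      using S(4) p(1) lam1_pos[of t] by simp
    finally show "hgt (- t) (x \<times> p) \<le> 2 * (lam 1 t * lam 3 t)" .
  qed (use lam3_pos[of t] in simp)
  finally show ?thesis by (simp add: power2_eq_square mult_ac)
qed

lemma ln_lam3_ge:
  assumes "f \<in> dual" "f \<noteq> 0" shows "- ln 3 - ln (hgt (- t) f) \<le> ln (lam 3 t)"
proof -
  have "ln 1 \<le> ln (3 * lam 3 t * hgt (- t) f)"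
    using lam3_ge[OF assms, of t] lam3_pos[of t] hgt_pos[OF assms(2), of "- t"]
    by (subst ln_le_cancel_iff) (auto intro: mult_pos_pos)
  then show ?thesis
    using lam3_pos[of t] hgt_pos[OF assms(2), of "- t"] by (simp add: ln_mult)
qed

lemma ln_lam1_lam3_le: "2 * ln (lam 1 t) + ln (lam 3 t) \<le> ln 2"
proof -
  have "ln ((lam 1 t)\<^sup>2 * lam 3 t) \<le> ln 2"
    using lam1_lam3_le[of t] lam1_pos[of t] lam3_pos[of t] by (subst ln_le_cancel_iff) auto
  then show ?thesis
    using lam1_pos[of t] lam3_pos[of t] by (simp add: ln_mult ln_realpow)
qed

lemma ln_lam1_lam3_ge: "- ln 6 \<le> ln (lam 1 t) + 2 * ln (lam 3 t)"
proof -
  have "ln 1 \<le> ln (6 * lam 1 t * (lam 3 t)\<^sup>2)"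
    using lam1_lam3_ge[of t] by (subst ln_le_cancel_iff) auto
  then show ?thesis
    using lam1_pos[of t] lam3_pos[of t] by (simp add: ln_mult ln_realpow)
qed

lemma ln_lam1_le_ln_lam3: "ln (lam 1 t) \<le> ln (lam 3 t)"
  using lam1_le_lam3[of t] lam1_pos[of t] lam3_pos[of t] by simp

section \<open>Exponential bounds for one minimum from the other\<close>

text \<open>This is \<open>crossing\<close> in the lattice, with \<open>ln_lam3_ge\<close> turning
  small cross products into lower bounds for the third minimum. The parameter \<open>lo\<close>
  forces \<open>s\<close> to be large.\<close>

lemma lattice_crossing:
  assumes \<alpha>: "0 \<le> \<alpha>" and \<kappa>: "\<kappa> < \<nu>1" and q: "0 \<le> q"
    and l1: "\<And>s. q \<le> s \<Longrightarrow> ln (lam 1 s) \<le> - \<alpha> * s"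
    and l3: "\<And>s. q \<le> s \<Longrightarrow> ln (lam 3 s) \<le> \<kappa> * s"
    and lo: "q \<le> lo"
  obtains T where "lo \<le> T" "\<And>t. T \<le> t \<Longrightarrow> \<exists>s\<ge>lo. 2 * \<alpha> * s - (1 + ln 2 + ln 3) \<le> ln (lam 3 s) \<and>
     (t \<le> s \<and> ln (lam 1 t) \<le> 1 - \<alpha> * s - \<nu>1 * (s - t) \<and>
       2 * \<alpha> * s - \<nu>2 * (s - t) - (1 + ln 2 + ln 3) \<le> ln (lam 3 t)
      \<or> s \<le> t \<and> 2 * \<alpha> * s + \<nu>1 * (t - s) - (1 + ln 2 + ln 3) \<le> ln (lam 3 t))"
proof
  have k: "0 < 1 - 2 * \<kappa>" using \<kappa> le sum1 by linarith
  \<comment> \<open>By \<open>ln_lam1_lam3_ge\<close>, \<open>ln (lam 1 t) + t\<close> is at least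
    \<open>(1 - 2 * \<kappa>) * t - ln 6\<close>; from \<open>T\<close> on this reaches
    \<open>lo + 1\<close>, so a falling height crosses the bound after \<open>lo\<close>.\<close>
  define T where "T = max lo ((lo + 1 + ln 6) / (1 - 2 * \<kappa>))"
  show "lo \<le> T" by (simp add: T_def)
  fix t assume T: "T \<le> t"
  then have t: "lo \<le> t" "lo + 1 + ln 6 \<le> (1 - 2 * \<kappa>) * t"
    using k by (auto simp: T_def field_simps)
  obtain x where x: "x \<in> lattice" "x \<noteq> 0" "\<forall>y\<in>lattice. y \<noteq> 0 \<longrightarrow> hgt t x \<le> hgt t y"
    using lattice_min[of t] by blast
  have lx: "hgt t x = lam 1 t" by (rule lam1_min[OF x, symmetric])
  \<comment> \<open>At \<open>hi\<close> a line of slope \<nu>1 from \<open>ln (lam 1 t)\<close> has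
    reached 1, which is above \<open>1 - \<alpha> * hi\<close>.\<close>
  define hi where "hi = max t ((1 - ln (lam 1 t) + \<nu>1 * t) / \<nu>1)"
  have hi: "t \<le> hi" "1 - ln (lam 1 t) + \<nu>1 * t \<le> \<nu>1 * hi"
    using pos by (auto simp: hi_def max_def field_simps)
  obtain s y where s: "lo \<le> s" "s \<le> hi" "y \<in> lattice" "x \<times> y \<noteq> 0"
    "ln (hgt (- s) (x \<times> y)) \<le> 2 * (- \<alpha> * s + 0) + 1 + ln 2"
    "t \<le> s \<and> ln (hgt t x) \<le> - \<alpha> * s + 0 + 1 - \<nu>1 * (s - t) \<and>
       ln (hgt (- t) (x \<times> y)) \<le> 2 * (- \<alpha> * s + 0) + 1 + ln 2 + \<nu>2 * (s - t)
     \<or> s \<le> t \<and> ln (hgt (- t) (x \<times> y)) \<le> 2 * (- \<alpha> * s + 0) + 1 + ln 2 - \<nu>1 * (t - s)"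
  proof (rule crossing[OF x t(1) hi(1), of "- \<alpha>" 0])
    show "\<exists>y\<in>lattice. y \<noteq> 0 \<and> ln (hgt s y) \<le> - \<alpha> * s + 0" if "lo \<le> s" for s
    proof -
      obtain z where z: "z \<in> lattice" "z \<noteq> 0"
        "\<forall>y\<in>lattice. y \<noteq> 0 \<longrightarrow> hgt s z \<le> hgt s y"
        using lattice_min[of s] by blast
      then show ?thesis using lam1_min[OF z] l1[of s] lo that by (intro bexI[of _ z]) auto
    qed
    have "0 \<le> \<alpha> * hi" using \<alpha> hi t lo q by simp
    then show "- \<alpha> * hi + 0 + 1 \<le> ln (hgt t x) + \<nu>1 * (hi - t)"
      using hi(2) unfolding lx by (simp add: algebra_simps)
    have "0 \<le> \<alpha> * lo" using \<alpha> lo q by simp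
    moreover have "- ln 6 - 2 * (\<kappa> * t) \<le> ln (lam 1 t)"
      using ln_lam1_lam3_ge[of t] l3[of t] lo t(1) by linarith
    ultimately show "- \<alpha> * lo + 0 + 1 \<le> ln (hgt t x) + (t - lo)"
      using t(2) unfolding lx by (simp add: algebra_simps)
  qed (rule that)
  note w = cross_lattice[OF x(1) s(3)]
  show "\<exists>s\<ge>lo. 2 * \<alpha> * s - (1 + ln 2 + ln 3) \<le> ln (lam 3 s) \<and>
     (t \<le> s \<and> ln (lam 1 t) \<le> 1 - \<alpha> * s - \<nu>1 * (s - t) \<and>
       2 * \<alpha> * s - \<nu>2 * (s - t) - (1 + ln 2 + ln 3) \<le> ln (lam 3 t)
      \<or> s \<le> t \<and> 2 * \<alpha> * s + \<nu>1 * (t - s) - (1 + ln 2 + ln 3) \<le> ln (lam 3 t))"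
    using s(1,5,6) ln_lam3_ge[OF w s(4), of s] ln_lam3_ge[OF w s(4), of t]
    unfolding lx by (intro exI[of _ s]) auto
qed

text \<open>At crossing parameters \<open>s\<close>, which can be forced to be arbitrarily large,
  the third minimum is at least \<open>exp (2 * \<alpha> * s)\<close> up to a constant. If
  \<open>2 * \<alpha>\<close> exceeded \<nu>1, and hence \<kappa>, this would contradict its upper
  bound.\<close>

lemma lam1_decay_bound:
  assumes "0 \<le> \<alpha>" "\<kappa> < \<nu>1" "0 \<le> q"
    and "\<And>s. q \<le> s \<Longrightarrow> ln (lam 1 s) \<le> - \<alpha> * s"
    and l3: "\<And>s. q \<le> s \<Longrightarrow> ln (lam 3 s) \<le> \<kappa> * s"
  shows "2 * \<alpha> \<le> \<nu>1"
proof (rule ccontr)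
  assume "\<not> 2 * \<alpha> \<le> \<nu>1"
  then have k: "0 < 2 * \<alpha> - \<kappa>" using assms(2) by linarith
  define lo where "lo = max q ((2 + ln 2 + ln 3) / (2 * \<alpha> - \<kappa>))"
  obtain s where s: "lo \<le> s" "2 * \<alpha> * s - (1 + ln 2 + ln 3) \<le> ln (lam 3 s)"
    using lattice_crossing[OF assms, of lo] by (metis lo_def max.cobounded1 order_refl)
  then have "2 + ln 2 + ln 3 \<le> (2 * \<alpha> - \<kappa>) * s"
    using k by (auto simp: lo_def field_simps)
  moreover have "ln (lam 3 s) \<le> \<kappa> * s" using l3 s by (simp add: lo_def)
  ultimately show False using s(2) by (simp add: algebra_simps)
qed

text \<open>In the rising case the two lower bounds for \<open>ln (lam 3 t)\<close> are combined with weights that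
  eliminate \<open>s - t\<close>.\<close>
lemma lam3_growth:
  assumes \<alpha>: "0 \<le> \<alpha>" and \<kappa>: "\<kappa> < \<nu>1" and q: "0 \<le> q"
    and l1: "\<And>s. q \<le> s \<Longrightarrow> ln (lam 1 s) \<le> - \<alpha> * s"
    and l3: "\<And>s. q \<le> s \<Longrightarrow> ln (lam 3 s) \<le> \<kappa> * s"
  obtains C T where "\<And>t. T \<le> t \<Longrightarrow> \<alpha> * (1 + \<nu>1) * t - C \<le> (1 + \<nu>2 - 3 * \<alpha>) * ln (lam 3 t)"
proof -
  have a: "2 * \<alpha> \<le> \<nu>1" by (rule lam1_decay_bound[OF assms])
  define D c where "D = 1 + \<nu>2 - 3 * \<alpha>" and "c = 1 + ln 2 + ln (3 :: real)"
  have D: "0 \<le> D" "1 + \<nu>1 \<le> 2 * D" using a le sum1 by (auto simp: D_def)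
  have c: "0 \<le> c" by (simp add: c_def)
  define C where "C = D * c + (\<alpha> + \<nu>1) * c + (\<nu>2 - 2 * \<alpha>) * (1 + ln 6)"
  have C: "D * c \<le> C" "(\<alpha> + \<nu>1) * c + (\<nu>2 - 2 * \<alpha>) * (1 + ln 6) \<le> C"
    using c D a le pos \<alpha> by (auto simp: C_def intro!: add_nonneg_nonneg mult_nonneg_nonneg)
  obtain T where T: "q \<le> T" "\<And>t. T \<le> t \<Longrightarrow> \<exists>s\<ge>q.
     (t \<le> s \<and> ln (lam 1 t) \<le> 1 - \<alpha> * s - \<nu>1 * (s - t) \<and> 2 * \<alpha> * s - \<nu>2 * (s - t) - c \<le> ln (lam 3 t)
      \<or> s \<le> t \<and> 2 * \<alpha> * s + \<nu>1 * (t - s) - c \<le> ln (lam 3 t))"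
    using lattice_crossing[OF assms order_refl] unfolding c_def by metis
  show thesis
  proof (rule that)
    fix t assume t: "T \<le> t"
    obtain s where "t \<le> s \<and> ln (lam 1 t) \<le> 1 - \<alpha> * s - \<nu>1 * (s - t) \<and>
        2 * \<alpha> * s - \<nu>2 * (s - t) - c \<le> ln (lam 3 t)
      \<or> s \<le> t \<and> 2 * \<alpha> * s + \<nu>1 * (t - s) - c \<le> ln (lam 3 t)"
      using T(2)[OF t] by blast
    then show "\<alpha> * (1 + \<nu>1) * t - C \<le> (1 + \<nu>2 - 3 * \<alpha>) * ln (lam 3 t)"
    proof (elim disjE conjE)
      assume s: "t \<le> s" "ln (lam 1 t) \<le> 1 - \<alpha> * s - \<nu>1 * (s - t)"
        "2 * \<alpha> * s - \<nu>2 * (s - t) - c \<le> ln (lam 3 t)"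
      have "\<alpha> * s + \<nu>1 * (s - t) - (1 + ln 6) \<le> 2 * ln (lam 3 t)"
        using s(2) ln_lam1_lam3_ge[of t] by linarith
      \<comment> \<open>Written in \<open>t\<close> and \<open>s - t\<close>, the two bounds have
        coefficients \<open>\<alpha> + \<nu>1\<close> and \<open>2 * \<alpha> - \<nu>2\<close> at
        \<open>s - t\<close>; the weights are chosen to cancel them, and are nonnegative by
        \<open>a\<close>.\<close>
      then have "(\<nu>2 - 2 * \<alpha>) * (\<alpha> * s + \<nu>1 * (s - t) - (1 + ln 6)) \<le> (\<nu>2 - 2 * \<alpha>) * (2 * ln (lam 3 t))"
        using a le by (intro mult_left_mono) auto
      moreover have "(\<alpha> + \<nu>1) * (2 * \<alpha> * s - \<nu>2 * (s - t) - c) \<le> (\<alpha> + \<nu>1) * ln (lam 3 t)"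
        using s(3) \<alpha> pos by (intro mult_left_mono) auto
      moreover have "(\<nu>2 - 2 * \<alpha>) * (\<alpha> * s + \<nu>1 * (s - t) - (1 + ln 6)) +
          (\<alpha> + \<nu>1) * (2 * \<alpha> * s - \<nu>2 * (s - t) - c) =
          \<alpha> * (2 * \<nu>1 + \<nu>2) * t - ((\<alpha> + \<nu>1) * c + (\<nu>2 - 2 * \<alpha>) * (1 + ln 6))"
        by (simp add: algebra_simps)
      moreover have "(\<nu>2 - 2 * \<alpha>) * (2 * ln (lam 3 t)) + (\<alpha> + \<nu>1) * ln (lam 3 t) =
          (\<nu>1 + \<nu>2 + \<nu>2 - 3 * \<alpha>) * ln (lam 3 t)"
        by (simp add: algebra_simps)
      moreover have "2 * \<nu>1 + \<nu>2 = 1 + \<nu>1" using sum1 by simp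
      ultimately show ?thesis using C(2) sum1 by simp
    next
      assume s: "s \<le> t" "2 * \<alpha> * s + \<nu>1 * (t - s) - c \<le> ln (lam 3 t)"
      \<comment> \<open>As \<open>2 * \<alpha>\<close> is at most \<nu>1, the bound is weakest at
        \<open>s = t\<close>, and that case still suffices since
        \<open>1 + \<nu>1 \<le> 2 * D\<close>.\<close>
      have "2 * \<alpha> * (t - s) \<le> \<nu>1 * (t - s)" using a s by (intro mult_right_mono) auto
      then have "2 * \<alpha> * t - c \<le> ln (lam 3 t)" using s by (simp add: algebra_simps)
      then have "D * (2 * \<alpha> * t - c) \<le> D * ln (lam 3 t)" using D by (intro mult_left_mono)
      moreover have "(1 + \<nu>1) * (\<alpha> * t) \<le> 2 * D * (\<alpha> * t)"
        using D t T q \<alpha> by (intro mult_right_mono) auto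
      ultimately show ?thesis using C(1) by (simp add: D_def algebra_simps)
    qed
  qed
qed

text \<open>The mirror image of \<open>lam3_growth\<close>: parameter \<open>r\<close> becomes
  \<open>- r\<close> in the dual lattice, \<open>dual_small\<close> provides points below
  \<open>\<beta> * s + ln 2\<close>, and cross products of dual points are lattice points that bound
  the first minimum.\<close>

lemma lam1_decay:
  assumes \<beta>: "0 \<le> \<beta>" and \<kappa>: "\<kappa> < \<nu>1" and q: "0 \<le> q"
    and l3: "\<And>s. q \<le> s \<Longrightarrow> \<beta> * s \<le> ln (lam 3 s)" "\<And>s. q \<le> s \<Longrightarrow> ln (lam 3 s) \<le> \<kappa> * s"
  obtains C T where "\<And>r. T \<le> r \<Longrightarrow> (1 + \<nu>2 + 3 * \<beta>) * ln (lam 1 r) \<le> C - \<beta> * (1 + \<nu>1) * r"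
proof -
  have "\<beta> * (q + 1) \<le> \<kappa> * (q + 1)" using l3[of "q + 1"] by simp
  then have b: "\<beta> < \<nu>1" using \<kappa> q by simp
  define D c where "D = 1 + \<nu>2 + 3 * \<beta>" and "c = 1 + 3 * ln (2 :: real)"
  define c' where "c' = 1 + 2 * ln 2 + ln (3 :: real)"
  have D: "0 \<le> D" "1 + \<nu>1 \<le> 2 * D" using pos le sum1 \<beta> by (auto simp: D_def)
  have c: "0 \<le> c" "0 \<le> c'" by (auto simp: c_def c'_def)
  define C where "C = D * c + (\<nu>1 - \<beta>) * c + (2 * \<beta> + \<nu>2) * c'"
  have C: "D * c \<le> C" "(\<nu>1 - \<beta>) * c + (2 * \<beta> + \<nu>2) * c' \<le> C"
    using c D b le pos \<beta> by (auto simp: C_def intro!: add_nonneg_nonneg mult_nonneg_nonneg)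
  \<comment> \<open>From \<open>T\<close> on, a rising dual height crosses the bound before
    \<open>- q\<close>, since \<open>n\<close> is at least
    \<open>- ln 3 - \<kappa> * r\<close>.\<close>
  define T where "T = max q ((1 + ln 2 + ln 3 + \<nu>1 * q) / (\<nu>1 - \<kappa>))"
  show thesis
  proof (rule that)
    fix r assume "T \<le> r"
    then have r: "q \<le> r" "1 + ln 2 + ln 3 + \<nu>1 * q \<le> (\<nu>1 - \<kappa>) * r"
      using \<kappa> by (auto simp: T_def field_simps)
    obtain x where x: "x \<in> dual" "x \<noteq> 0" "\<forall>y\<in>dual. y \<noteq> 0 \<longrightarrow> hgt (- r) x \<le> hgt (- r) y"
      using dual_min[of "- r"] by blast
    define n where "n = ln (hgt (- r) x)"
    have n: "- ln 3 - n \<le> ln (lam 3 r)" using ln_lam3_ge[OF x(1,2), of r] by (simp add: n_def)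
    \<comment> \<open>The parameter may run arbitrarily far to the left, so \<open>lo\<close> is put
      where a falling height has reached \<open>1 + ln 2\<close>.\<close>
    define lo where "lo = min (- r) (n - r - 1 - ln 2)"
    have lo: "lo \<le> - r" "lo \<le> n - r - 1 - ln 2" by (auto simp: lo_def)
    obtain s y where s: "lo \<le> s" "s \<le> - q" "y \<in> dual" "x \<times> y \<noteq> 0"
      "ln (hgt (- s) (x \<times> y)) \<le> 2 * (\<beta> * s + ln 2) + 1 + ln 2"
      "- r \<le> s \<and> ln (hgt (- r) x) \<le> \<beta> * s + ln 2 + 1 - \<nu>1 * (s - - r) \<and>
         ln (hgt (- (- r)) (x \<times> y)) \<le> 2 * (\<beta> * s + ln 2) + 1 + ln 2 + \<nu>2 * (s - - r)
       \<or> s \<le> - r \<and> ln (hgt (- (- r)) (x \<times> y)) \<le> 2 * (\<beta> * s + ln 2) + 1 + ln 2 - \<nu>1 * (- r - s)"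
    proof (rule crossing[OF x lo(1), of "- q" \<beta> "ln 2"])
      show "- r \<le> - q" using r by simp
      show "\<exists>y\<in>dual. y \<noteq> 0 \<and> ln (hgt s y) \<le> \<beta> * s + ln 2" if "s \<le> - q" for s
      proof -
        obtain f where f: "f \<in> dual" "f \<noteq> 0" "lam 3 (- s) * hgt s f \<le> 2"
          using dual_small[of "- s"] by auto
        have "ln (lam 3 (- s) * hgt s f) \<le> ln 2"
          using f hgt_pos[of f s] lam3_pos[of "- s"] by (subst ln_le_cancel_iff) auto
        then have "ln (lam 3 (- s)) + ln (hgt s f) \<le> ln 2"
          using hgt_pos[OF f(2), of s] lam3_pos[of "- s"] by (simp add: ln_mult)
        then show ?thesis using f l3(1)[of "- s"] that by (intro bexI[of _ f]) auto
      qed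
      have "0 \<le> \<beta> * q" using \<beta> q by simp
      then show "\<beta> * - q + ln 2 + 1 \<le> ln (hgt (- r) x) + \<nu>1 * (- q - - r)"
        using n l3(2)[OF r(1)] r(2) by (simp add: n_def algebra_simps)
      have "\<beta> * lo \<le> 0" using \<beta> lo r q by (simp add: mult_nonneg_nonpos)
      then show "\<beta> * lo + ln 2 + 1 \<le> ln (hgt (- r) x) + (- r - lo)"
        using lo(2) by (simp add: n_def)
    qed (rule that)
    have "lam 1 r \<le> hgt r (x \<times> y)" using cross_dual[OF x(1) s(3)] s(4) by (rule lam1_le)
    then have l: "ln (lam 1 r) \<le> ln (hgt r (x \<times> y))" using lam1_pos[of r] by simp
    from s(6) show "(1 + \<nu>2 + 3 * \<beta>) * ln (lam 1 r) \<le> C - \<beta> * (1 + \<nu>1) * r"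
    proof (elim disjE conjE)
      assume t: "- r \<le> s" "ln (hgt (- r) x) \<le> \<beta> * s + ln 2 + 1 - \<nu>1 * (s - - r)"
        "ln (hgt (- (- r)) (x \<times> y)) \<le> 2 * (\<beta> * s + ln 2) + 1 + ln 2 + \<nu>2 * (s - - r)"
      have "2 * ln (lam 1 r) \<le> \<beta> * s - \<nu>1 * (s + r) + c'"
        using t(2) n ln_lam1_lam3_le[of r] unfolding n_def c'_def by simp
      \<comment> \<open>In \<open>r\<close> and \<open>s + r\<close> the two upper bounds have
        coefficients \<open>\<beta> - \<nu>1\<close> and \<open>2 * \<beta> + \<nu>2\<close> at
        \<open>s + r\<close>; the weights cancel them.\<close>
      then have "(2 * \<beta> + \<nu>2) * (2 * ln (lam 1 r)) \<le> (2 * \<beta> + \<nu>2) * (\<beta> * s - \<nu>1 * (s + r) + c')"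
        using \<beta> pos le by (intro mult_left_mono) auto
      moreover have "ln (lam 1 r) \<le> 2 * (\<beta> * s) + \<nu>2 * (s + r) + c"
        using t(3) l by (simp add: c_def)
      then have "(\<nu>1 - \<beta>) * ln (lam 1 r) \<le> (\<nu>1 - \<beta>) * (2 * (\<beta> * s) + \<nu>2 * (s + r) + c)"
        using b by (intro mult_left_mono) auto
      moreover have "(2 * \<beta> + \<nu>2) * (\<beta> * s - \<nu>1 * (s + r) + c') +
          (\<nu>1 - \<beta>) * (2 * (\<beta> * s) + \<nu>2 * (s + r) + c) =
          (\<nu>1 - \<beta>) * c + (2 * \<beta> + \<nu>2) * c' - \<beta> * (2 * \<nu>1 + \<nu>2) * r"
        by (simp add: algebra_simps)
      moreover have "(2 * \<beta> + \<nu>2) * (2 * ln (lam 1 r)) + (\<nu>1 - \<beta>) * ln (lam 1 r) =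
          (\<nu>1 + \<nu>2 + \<nu>2 + 3 * \<beta>) * ln (lam 1 r)"
        by (simp add: algebra_simps)
      moreover have "2 * \<nu>1 + \<nu>2 = 1 + \<nu>1" using sum1 by simp
      ultimately show ?thesis using C(2) sum1 by simp
    next
      assume t: "s \<le> - r"
        "ln (hgt (- (- r)) (x \<times> y)) \<le> 2 * (\<beta> * s + ln 2) + 1 + ln 2 - \<nu>1 * (- r - s)"
      have "0 \<le> \<nu>1 * (- r - s)" "\<beta> * s \<le> \<beta> * - r"
        using t(1) pos mult_left_mono[OF t(1) \<beta>] by simp_all
      then have "ln (lam 1 r) \<le> c - 2 * \<beta> * r" using t(2) l by (simp add: c_def)
      then have "D * ln (lam 1 r) \<le> D * (c - 2 * \<beta> * r)" using D by (intro mult_left_mono)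
      moreover have "(1 + \<nu>1) * (\<beta> * r) \<le> 2 * D * (\<beta> * r)"
        using D r q \<beta> by (intro mult_right_mono) auto
      ultimately show ?thesis using C(1) by (simp add: D_def algebra_simps)
    qed
  qed
qed

end

section \<open>Passage to the lower and upper limits\<close>

lemma Liminf_ratio_ge:
  fixes f :: "real \<Rightarrow> real"
  assumes D: "0 < D" and f: "\<And>t. T \<le> t \<Longrightarrow> m * t - C \<le> D * f t"
  shows "ereal (m / D) \<le> Liminf at_top (\<lambda>t. ereal (f t / t))"
proof -
  have "((\<lambda>t. m / D - C / D * inverse t) \<longlongrightarrow> m / D - C / D * 0) at_top"
    by (intro tendsto_intros tendsto_inverse_0_at_top filterlim_ident)
  then have "((\<lambda>t. ereal (m / D - C / D * inverse t)) \<longlongrightarrow> ereal (m / D)) at_top"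
    by simp
  then have "ereal (m / D) = Liminf at_top (\<lambda>t. ereal (m / D - C / D * inverse t))"
    by (intro lim_imp_Liminf[symmetric]) auto
  also have "\<dots> \<le> Liminf at_top (\<lambda>t. ereal (f t / t))"
  proof (rule Liminf_mono)
    show "\<forall>\<^sub>F t in at_top. ereal (m / D - C / D * inverse t) \<le> ereal (f t / t)"
      using eventually_ge_at_top[of "max 1 T"]
    proof eventually_elim
      case (elim t)
      then have "m * t - C \<le> D * f t" "0 < t" using f by auto
      then have "(m * t - C) / (D * t) \<le> D * f t / (D * t)"
        using D by (intro divide_right_mono) auto
      then show ?case using D \<open>0 < t\<close> by (simp add: field_simps)
    qed
  qed
  finally show ?thesis .
qed

lemma Limsup_ratio_le:
  fixes f :: "real \<Rightarrow> real"
  assumes "0 < D" and f: "\<And>t. T \<le> t \<Longrightarrow> D * f t \<le> C - m * t"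
  shows "Limsup at_top (\<lambda>t. ereal (f t / t)) \<le> ereal (- m / D)"
proof -
  have "ereal (m / D) \<le> Liminf at_top (\<lambda>t. ereal (- f t / t))"
    using f by (intro Liminf_ratio_ge[OF assms(1), of T m C]) (simp add: algebra_simps)
  also have "\<dots> = - Limsup at_top (\<lambda>t. ereal (f t / t))"
    using ereal_Liminf_uminus[of at_top "\<lambda>t. ereal (f t / t)"] by simp
  finally have "- (- Limsup at_top (\<lambda>t. ereal (f t / t))) \<le> - ereal (m / D)"
    by (simp only: ereal_minus_le_minus)
  then show ?thesis by simp
qed

lemma Limsup_ratio_less:
  fixes f :: "real \<Rightarrow> real"
  assumes "Limsup at_top (\<lambda>t. ereal (f t / t)) < ereal a"
  obtains T where "0 \<le> T" "\<And>t. T \<le> t \<Longrightarrow> f t \<le> a * t"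
proof -
  obtain T where T: "\<And>t. T \<le> t \<Longrightarrow> f t / t < a"
    using Limsup_lessD[OF assms] by (auto simp: eventually_at_top_linorder)
  show thesis
  proof (rule that[of "max 1 T"])
    fix t assume "max 1 T \<le> t"
    then show "f t \<le> a * t" using T[of t] by (simp add: field_simps)
  qed simp
qed

lemma Liminf_ratio_greater:
  fixes f :: "real \<Rightarrow> real"
  assumes "ereal a < Liminf at_top (\<lambda>t. ereal (f t / t))"
  obtains T where "0 \<le> T" "\<And>t. T \<le> t \<Longrightarrow> a * t \<le> f t"
proof -
  obtain T where T: "\<And>t. T \<le> t \<Longrightarrow> a < f t / t"
    using less_LiminfD[OF assms] by (auto simp: eventually_at_top_linorder)
  show thesis
  proof (rule that[of "max 1 T"])
    fix t assume "max 1 T \<le> t"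
    then show "a * t \<le> f t" using T[of t] by (simp add: field_simps)
  qed simp
qed

context weighted_lattice
begin

lemma log_minimum_eq: "log_minimum \<nu>1 \<nu>2 \<xi>1 \<xi>2 i t = ln (lam i t)"
  by (simp add: log_minimum_def lam_def)

text \<open>Every \<alpha> below \<open>a\<close> and every \<beta> below \<open>b\<close> is an
  eventual exponential rate, to which the growth and decay lemmas apply; density then gives the
  inequalities for \<open>a\<close> and \<open>b\<close>, with denominators cleared.\<close>

lemma phi_bounds:
  assumes "phi_upper \<nu>1 \<nu>2 \<xi>1 \<xi>2 3 < ereal \<nu>1"
  obtains a b where "phi_upper \<nu>1 \<nu>2 \<xi>1 \<xi>2 1 = ereal (- a)" "phi_lower \<nu>1 \<nu>2 \<xi>1 \<xi>2 3 = ereal b"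
    "0 \<le> a" "0 \<le> b" "b * (1 + \<nu>1 - 3 * a) \<le> a * (1 + \<nu>2)" "a * (1 + \<nu>1 + 3 * b) \<le> b * (1 + \<nu>2)"
proof -
  let ?U = "phi_upper \<nu>1 \<nu>2 \<xi>1 \<xi>2 1" and ?L = "phi_lower \<nu>1 \<nu>2 \<xi>1 \<xi>2 3"
  note U = phi_upper_def[of \<nu>1 \<nu>2 \<xi>1 \<xi>2, unfolded log_minimum_eq]
    and L = phi_lower_def[of \<nu>1 \<nu>2 \<xi>1 \<xi>2, unfolded log_minimum_eq]
  \<comment> \<open>A rate strictly between the upper limit and \<nu>1 turns the hypothesis into a
    bound valid for all large parameters.\<close>
  obtain \<kappa> where \<kappa>: "phi_upper \<nu>1 \<nu>2 \<xi>1 \<xi>2 3 < ereal \<kappa>" "\<kappa> < \<nu>1"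
    using ereal_dense2[OF assms] by auto
  obtain q0 where q0: "0 \<le> q0" "\<And>s. q0 \<le> s \<Longrightarrow> ln (lam 3 s) \<le> \<kappa> * s"
    using Limsup_ratio_less[OF \<kappa>(1)[unfolded U]] by blast
  have decay: "2 * \<alpha> \<le> \<nu>1 \<and> ereal (\<alpha> * (1 + \<nu>1) / (1 + \<nu>2 - 3 * \<alpha>)) \<le> ?L"
    if \<alpha>: "0 \<le> \<alpha>" "?U < ereal (- \<alpha>)" for \<alpha>
  proof -
    obtain q1 where q1: "0 \<le> q1" "\<And>s. q1 \<le> s \<Longrightarrow> ln (lam 1 s) \<le> - \<alpha> * s"
      using Limsup_ratio_less[OF \<alpha>(2)[unfolded U]] by blast
    define q where "q = max q0 q1"
    have q: "0 \<le> q" "\<And>s. q \<le> s \<Longrightarrow> ln (lam 1 s) \<le> - \<alpha> * s" "\<And>s. q \<le> s \<Longrightarrow> ln (lam 3 s) \<le> \<kappa> * s"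
      using q0 q1 by (auto simp: q_def)
    have a: "2 * \<alpha> \<le> \<nu>1" by (rule lam1_decay_bound[OF \<alpha>(1) \<kappa>(2) q])
    obtain C T where "\<And>t. T \<le> t \<Longrightarrow> \<alpha> * (1 + \<nu>1) * t - C \<le> (1 + \<nu>2 - 3 * \<alpha>) * ln (lam 3 t)"
      using lam3_growth[OF \<alpha>(1) \<kappa>(2) q] by blast
    then show ?thesis
      unfolding L using a le sum1 by (intro conjI Liminf_ratio_ge) auto
  qed
  have growth: "?U \<le> ereal (- (\<beta> * (1 + \<nu>1)) / (1 + \<nu>2 + 3 * \<beta>))"
    if \<beta>: "0 \<le> \<beta>" "ereal \<beta> < ?L" for \<beta>
  proof -
    obtain q1 where q1: "0 \<le> q1" "\<And>s. q1 \<le> s \<Longrightarrow> \<beta> * s \<le> ln (lam 3 s)"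
      using Liminf_ratio_greater[OF \<beta>(2)[unfolded L]] by blast
    define q where "q = max q0 q1"
    have q: "0 \<le> q" "\<And>s. q \<le> s \<Longrightarrow> \<beta> * s \<le> ln (lam 3 s)" "\<And>s. q \<le> s \<Longrightarrow> ln (lam 3 s) \<le> \<kappa> * s"
      using q0 q1 by (auto simp: q_def)
    obtain C T where "\<And>r. T \<le> r \<Longrightarrow> (1 + \<nu>2 + 3 * \<beta>) * ln (lam 1 r) \<le> C - \<beta> * (1 + \<nu>1) * r"
      using lam1_decay[OF \<beta>(1) \<kappa>(2) q] by blast
    then show ?thesis
      unfolding U using \<beta>(1) pos le by (intro Limsup_ratio_le) auto
  qed
  have "ln (lam 1 t) \<le> ln 2 / 3 - 0 * t" for t
    using ln_lam1_lam3_le[of t] ln_lam1_le_ln_lam3[of t] by simp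
  then have U0: "?U \<le> 0"
    using Limsup_ratio_le[of 1 0 "\<lambda>t. ln (lam 1 t)" "ln 2 / 3" 0]
    unfolding U by (simp add: zero_ereal_def)
  have "0 * t - ln 6 / 3 \<le> ln (lam 3 t)" for t
    using ln_lam1_lam3_ge[of t] ln_lam1_le_ln_lam3[of t] by simp
  then have L0: "0 \<le> ?L"
    using Liminf_ratio_ge[of 1 0 0 "ln 6 / 3" "\<lambda>t. ln (lam 3 t)"]
    unfolding L by (simp add: zero_ereal_def)
  have "?L \<le> phi_upper \<nu>1 \<nu>2 \<xi>1 \<xi>2 3"
    unfolding U L by (rule Liminf_le_Limsup) simp
  then have L1: "?L < ereal \<nu>1" using assms by (rule le_less_trans)
  \<comment> \<open>The bound \<open>2 * \<alpha> \<le> \<nu>1\<close> from \<open>decay\<close>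
    keeps the upper limit away from minus infinity, so that \<open>a\<close> is a real
    number.\<close>
  have U1: "ereal (- \<nu>1 / 2) \<le> ?U"
  proof (rule ccontr)
    assume "\<not> ?thesis"
    then obtain x where x: "?U < ereal x" "ereal x < ereal (- \<nu>1 / 2)"
      using ereal_dense2[of ?U "ereal (- \<nu>1 / 2)"] by (auto simp only: not_le)
    then show False using decay[of "- x"] pos by auto
  qed
  obtain a b where ab: "?U = ereal (- a)" "?L = ereal b"
  proof -
    obtain u where "?U = ereal u" using U0 U1 by (cases ?U) auto
    moreover obtain l where "?L = ereal l" using L0 L1 by (cases ?L) auto
    ultimately show thesis using that[of "- u" l] by simp
  qed
  have a: "0 \<le> a" "2 * a \<le> \<nu>1" and b: "0 \<le> b" "b < \<nu>1"
    using U0 U1 L0 L1 unfolding ab by simp_all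
  have d: "0 < 1 + \<nu>1 - 3 * a" "0 < 1 + \<nu>1 + 3 * b" using a b pos le sum1 by auto
  have "a * (1 + \<nu>1 + 3 * b) \<le> b * (1 + \<nu>2)"
  \<comment> \<open>For positive \<open>a\<close> the rates in the open interval from 0 to
    \<open>a\<close> approximate it; the inequality from \<open>decay\<close> is solved for \<alpha>
    before the limit.\<close>
  proof (cases "a = 0")
    case False
    have "a \<le> b * (1 + \<nu>2) / (1 + \<nu>1 + 3 * b)"
    proof (rule dense_le_bounded)
      show "0 < a" using False a by simp
      fix \<alpha> assume \<alpha>: "0 < \<alpha>" "\<alpha> < a"
      have D: "0 < 1 + \<nu>2 - 3 * \<alpha>" using \<alpha> a le sum1 by linarith
      have "\<alpha> * (1 + \<nu>1) / (1 + \<nu>2 - 3 * \<alpha>) \<le> b"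
        using decay[of \<alpha>, unfolded ab] \<alpha> by simp
      then show "\<alpha> \<le> b * (1 + \<nu>2) / (1 + \<nu>1 + 3 * b)"
        using D d by (simp add: field_simps)
    qed
    then show ?thesis using d by (simp add: field_simps)
  qed (use b pos le in simp)
  moreover have "b * (1 + \<nu>1 - 3 * a) \<le> a * (1 + \<nu>2)"
  proof (cases "b = 0")
    case False
    have "b \<le> a * (1 + \<nu>2) / (1 + \<nu>1 - 3 * a)"
    proof (rule dense_le_bounded)
      show "0 < b" using False b by simp
      fix \<beta> assume \<beta>: "0 < \<beta>" "\<beta> < b"
      have D: "0 < 1 + \<nu>2 + 3 * \<beta>" using \<beta> pos le by linarith
      have "- a \<le> - (\<beta> * (1 + \<nu>1)) / (1 + \<nu>2 + 3 * \<beta>)"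
        using growth[of \<beta>, unfolded ab] \<beta> by simp
      then have "\<beta> * (1 + \<nu>1) / (1 + \<nu>2 + 3 * \<beta>) \<le> a" by simp
      then show "\<beta> \<le> a * (1 + \<nu>2) / (1 + \<nu>1 - 3 * a)"
        using D d by (simp add: field_simps)
    qed
    then show ?thesis using d by (simp add: field_simps)
  qed (use a pos le in simp)
  ultimately show thesis by (intro that[OF ab a(1) b(1)])
qed

end

theorem theorem4p1:
  fixes \<nu>1 \<nu>2 \<xi>1 \<xi>2 :: real
  assumes "0 < \<nu>1" and "\<nu>1 \<le> \<nu>2" and "\<nu>1 + \<nu>2 = 1"
    and "\<And>a b c :: rat. of_rat a + of_rat b * \<xi>1 + of_rat c * \<xi>2 = 0 \<Longrightarrow> a = 0 \<and> b = 0 \<and> c = 0"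
    and "phi_upper \<nu>1 \<nu>2 \<xi>1 \<xi>2 3 < ereal \<nu>1"
  shows "ereal (2 - \<nu>1) * phi_upper \<nu>1 \<nu>2 \<xi>1 \<xi>2 1 + ereal (1 + \<nu>1) * phi_lower \<nu>1 \<nu>2 \<xi>1 \<xi>2 3
           \<le> - 3 * phi_upper \<nu>1 \<nu>2 \<xi>1 \<xi>2 1 * phi_lower \<nu>1 \<nu>2 \<xi>1 \<xi>2 3
       \<and> - 3 * phi_upper \<nu>1 \<nu>2 \<xi>1 \<xi>2 1 * phi_lower \<nu>1 \<nu>2 \<xi>1 \<xi>2 3
           \<le> ereal (2 - \<nu>2) * phi_upper \<nu>1 \<nu>2 \<xi>1 \<xi>2 1 + ereal (1 + \<nu>2) * phi_lower \<nu>1 \<nu>2 \<xi>1 \<xi>2 3"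
proof -
  interpret weighted_lattice \<nu>1 \<nu>2 \<xi>1 \<xi>2
    using assms(1-3) by unfold_locales
  obtain a b where ab: "phi_upper \<nu>1 \<nu>2 \<xi>1 \<xi>2 1 = ereal (- a)" "phi_lower \<nu>1 \<nu>2 \<xi>1 \<xi>2 3 = ereal b"
    "0 \<le> a" "0 \<le> b" "b * (1 + \<nu>1 - 3 * a) \<le> a * (1 + \<nu>2)" "a * (1 + \<nu>1 + 3 * b) \<le> b * (1 + \<nu>2)"
    by (rule phi_bounds[OF assms(5)])
  \<comment> \<open>With this, 2 - \<nu>1 = 1 + \<nu>2 and 2 - \<nu>2 = 1 + \<nu>1, and the two
    claims become the two inequalities for \<open>a\<close> and \<open>b\<close>.\<close>
  have \<nu>: "\<nu>2 = 1 - \<nu>1" using assms(3) by simp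
  have three: "- 3 = ereal (- 3)" by simp
  show ?thesis
    unfolding ab(1,2) three using ab(5,6) by (simp add: \<nu> algebra_simps)
qed

end
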